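(* Let $\alpha\in\mathbb{R}$. Up to a linear isometry and a dilation of $\mathbb{L}^2$, the $\alpha$-stationary timelike curves contained in $\mathcal{C}^-$ are parametrized by $\gamma(s)=\rho(s)(\sinh s,\cosh s)$, where $$\rho(s)=\begin{cases}\sinh((\alpha+1)s)^{\frac{-1}{\alpha+1}}, & \alpha\neq -1,\\ e^{cs}, & \alpha=-1,\ c^2>1\ (c\in\mathbb{R}\text{ constant}).\end{cases}$$ Moreover: (1) If $\alpha>0$, then a branch of $\gamma$ touches $\mathcal{C}$ orthogonally and the other one is asymptotic to the $y$-axis. (2) If $-1<\alpha<0$, then a branch of $\gamma$ goes to $\mathcal{C}$ tangentially. (3) If $\alpha=-1$, then a branch of $\gamma$ goes to $(0,0)$ and tangentially to $\mathcal{C}$. (4) If $\alpha<-1$, then a branch of $\gamma$ goes to $(0,0)$ tangentially to the $y$-axis and the other branch is asymptotic to a translation of the lightlike cone $\mathcal{C}$.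
   Context: $\mathbb{L}^2=(\mathbb{R}^2,\langle\cdot,\cdot\rangle)$ with $\langle\cdot,\cdot\rangle=dx^2-dy^2$. $\mathcal{C}=\{p\in\mathbb{L}^2:\langle p,p\rangle=0\}$ is the lightlike cone and $\mathcal{C}^-=\{p:\langle p,p\rangle<0\}$. A smooth regular curve is spacelike (resp. timelike) if $\langle\gamma',\gamma'\rangle>0$ (resp. $<0$) everywhere. Let $N$ be a unit normal field along $\gamma$ ($\langle N,\gamma'\rangle=0$, $|\langle N,N\rangle|=1$). When $\gamma$ is parametrized by arc-length ($|\langle\gamma',\gamma'\rangle|=1$) its curvature is $\kappa=-\langle N,\gamma''\rangle$. A spacelike or timelike curve $\gamma\colon I\to\mathbb{L}^2$ with $\gamma(I)\cap\mathcal{C}=\emptyset$ is called $\alpha$-stationary if $\kappa=-\alpha\,\dfrac{\langle N,\gamma\rangle}{|\langle\gamma,\gamma\rangle|}$ along $\gamma$ (this condition does not depend on the choice of sign of $N$). A dilation is a map $p\mapsto\lambda p$, $\lambda>0$. Curves are considered on their maximal domain: $\{s:(\alpha+1)s>0\}$ if $\alpha\ne-1$, and $\mathbb{R}$ if $\alpha=-1$. A branch of $\gamma$ is one of its two ends (as $s$ tends to an endpoint of the domain). A branch is asymptotic to a line if it goes to infinity approaching that line; it is asymptotic to a translation of $\mathcal{C}$ if it is asymptotic to one of the two lines forming the translated cone. "Touches/goes to $\mathcal{C}$" is understood in the limit: $\gamma(s)$ tends to a point of $\mathcal{C}$, which is not the origin unless said otherwise, and the contact is tangential (resp. orthogonal)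 if the limit of the tangent direction is that of a line of $\mathcal{C}$ through the limit point (resp. is perpendicular to it in the Euclidean sense).
   Formalization: The classification is stated for curves not contained in a straight line through the origin: timelike pieces of such lines in C^- have κ=0 and ⟨N,γ⟩=0, so they are α-stationary for every α but are not of the form ρ(s)(sinh s, cosh s). *)

theory Defs
  imports "HOL-Analysis.Analysis"
begin

section \<open>The Lorentzian plane\<close>

text \<open>The plane is \<^typ>\<open>real \<times> real\<close> as a vector space; \<open>norm\<close>, \<open>inner\<close>, \<open>infdist\<close> and limits
  are the Euclidean ones.\<close>

definition lor :: "real \<times> real \<Rightarrow> real \<times> real \<Rightarrow> real"
  where "lor p q = fst p * fst q - snd p * snd q"

definition light_cone :: "(real \<times> real) set"
  where "light_cone = {p. lor p p = 0}"

definition neg_region :: "(real \<times> real) set"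
  where "neg_region = {p. lor p p < 0}"

definition linear_isometry :: "(real \<times> real \<Rightarrow> real \<times> real) \<Rightarrow> bool"
  where "linear_isometry T \<longleftrightarrow> linear T \<and> (\<forall>p q. lor (T p) (T q) = lor p q)"

definition straight_line :: "real \<times> real \<Rightarrow> real \<times> real \<Rightarrow> (real \<times> real) set"
  where "straight_line p v = range (\<lambda>r::real. p + r *\<^sub>R v)"

section \<open>Curves\<close>

definition open_interval :: "real set \<Rightarrow> bool"
  where "open_interval I \<longleftrightarrow> open I \<and> is_interval I \<and> I \<noteq> {}"

definition vderiv :: "(real \<Rightarrow> 'a::real_normed_vector) \<Rightarrow> real \<Rightarrow> 'a"
  where "vderiv f = (\<lambda>t. vector_derivative f (at t))"

text \<open>Only used for open \<open>I\<close>: all iterated derivatives exist on \<open>I\<close>.\<close>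

definition smooth :: "(real \<Rightarrow> 'a::real_normed_vector) \<Rightarrow> real set \<Rightarrow> bool"
  where "smooth f I \<longleftrightarrow> (\<forall>n. \<forall>t\<in>I. (vderiv ^^ n) f differentiable (at t))"

definition regular_curve :: "(real \<Rightarrow> real \<times> real) \<Rightarrow> real set \<Rightarrow> bool"
  where "regular_curve \<gamma> I \<longleftrightarrow>
    open_interval I \<and> smooth \<gamma> I \<and> (\<forall>t\<in>I. vderiv \<gamma> t \<noteq> 0)"

definition spacelike :: "(real \<Rightarrow> real \<times> real) \<Rightarrow> real set \<Rightarrow> bool"
  where "spacelike \<gamma> I \<longleftrightarrow> (\<forall>t\<in>I. lor (vderiv \<gamma> t) (vderiv \<gamma> t) > 0)"

definition timelike :: "(real \<Rightarrow> real \<times> real) \<Rightarrow> real set \<Rightarrow> bool"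
  where "timelike \<gamma> I \<longleftrightarrow> (\<forall>t\<in>I. lor (vderiv \<gamma> t) (vderiv \<gamma> t) < 0)"

definition reparametrization :: "(real \<Rightarrow> real) \<Rightarrow> real set \<Rightarrow> real set \<Rightarrow> bool"
  where "reparametrization \<phi> J I \<longleftrightarrow>
    open_interval J \<and> open_interval I \<and> smooth \<phi> J \<and> (\<forall>t\<in>J. vderiv \<phi> t \<noteq> 0) \<and>
    bij_betw \<phi> J I"

definition arc_length :: "(real \<Rightarrow> real \<times> real) \<Rightarrow> real set \<Rightarrow> bool"
  where "arc_length \<gamma> I \<longleftrightarrow> (\<forall>t\<in>I. \<bar>lor (vderiv \<gamma> t) (vderiv \<gamma> t)\<bar> = 1)"

definition unit_normal_field ::
    "(real \<Rightarrow> real \<times> real) \<Rightarrow> real set \<Rightarrow> (real \<Rightarrow> real \<times> real) \<Rightarrow> bool"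
  where "unit_normal_field \<gamma> I N \<longleftrightarrow>
    smooth N I \<and> (\<forall>t\<in>I. lor (N t) (vderiv \<gamma> t) = 0 \<and> \<bar>lor (N t) (N t)\<bar> = 1)"

text \<open>Meaningful for curves parametrized by arc-length.\<close>

definition curvature :: "(real \<Rightarrow> real \<times> real) \<Rightarrow> (real \<Rightarrow> real \<times> real) \<Rightarrow> real \<Rightarrow> real"
  where "curvature \<gamma> N t = - lor (N t) (vderiv (vderiv \<gamma>) t)"

text \<open>A curve with an arbitrary parametrization is stationary when its arc-length
  reparametrization (unique up to translation and reversal of the parameter) satisfies the
  curvature equation; the equation does not depend on the choice of \<open>N\<close>.\<close>

definition stationary :: "real \<Rightarrow> (real \<Rightarrow> real \<times> real) \<Rightarrow> real set \<Rightarrow> bool"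
  where "stationary \<alpha> \<gamma> I \<longleftrightarrow>
    regular_curve \<gamma> I \<and> (spacelike \<gamma> I \<or> timelike \<gamma> I) \<and> \<gamma> ` I \<inter> light_cone = {} \<and>
    (\<exists>J \<phi> N. reparametrization \<phi> J I \<and> arc_length (\<gamma> \<circ> \<phi>) J \<and>
      unit_normal_field (\<gamma> \<circ> \<phi>) J N \<and>
      (\<forall>t\<in>J. curvature (\<gamma> \<circ> \<phi>) N t =
         - \<alpha> * (lor (N t) (\<gamma> (\<phi> t)) / \<bar>lor (\<gamma> (\<phi> t)) (\<gamma> (\<phi> t))\<bar>)))"

text \<open>Timelike pieces of lines through the origin satisfy the stationarity equation for every
  \<open>\<alpha>\<close> (both sides vanish) but cannot be written in the polar form \<open>\<rho>(s) (sinh s, cosh s)\<close>;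
  the classification concerns the remaining curves.\<close>

definition radial :: "(real \<Rightarrow> real \<times> real) \<Rightarrow> real set \<Rightarrow> bool"
  where "radial \<gamma> I \<longleftrightarrow> (\<exists>v. \<gamma> ` I \<subseteq> straight_line 0 v)"

section \<open>The explicit curves\<close>

text \<open>The parameter \<open>c\<close> is only relevant for \<open>\<alpha> = -1\<close>. On \<open>std_domain\<close> the base of \<open>powr\<close> is
  positive.\<close>

definition std_radius :: "real \<Rightarrow> real \<Rightarrow> real \<Rightarrow> real"
  where "std_radius \<alpha> c s =
    (if \<alpha> = -1 then exp (c * s) else sinh ((\<alpha> + 1) * s) powr (- 1 / (\<alpha> + 1)))"

definition std_curve :: "real \<Rightarrow> real \<Rightarrow> real \<Rightarrow> real \<times> real"
  where "std_curve \<alpha> c s = std_radius \<alpha> c s *\<^sub>R (sinh s, cosh s)"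

definition std_domain :: "real \<Rightarrow> real set"
  where "std_domain \<alpha> = (if \<alpha> = -1 then UNIV else {s. (\<alpha> + 1) * s > 0})"

section \<open>Behaviour of the ends\<close>

text \<open>A branch is the filter of parameters tending to one endpoint of \<open>std_domain \<alpha>\<close>.\<close>

definition branches :: "real \<Rightarrow> real filter set"
  where "branches \<alpha> =
    (if \<alpha> > -1 then {at_right 0, at_top}
     else if \<alpha> < -1 then {at_bot, at_left 0}
     else {at_bot, at_top})"

definition asymptotic_to_line ::
    "(real \<Rightarrow> real \<times> real) \<Rightarrow> real filter \<Rightarrow> (real \<times> real) set \<Rightarrow> bool"
  where "asymptotic_to_line \<gamma> F L \<longleftrightarrow>
    filterlim \<gamma> at_infinity F \<and> ((\<lambda>s. infdist (\<gamma> s) L) \<longlongrightarrow> 0) F"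

definition y_axis :: "(real \<times> real) set"
  where "y_axis = straight_line 0 (0, 1)"

text \<open>The cone \<open>p + light_cone\<close> consists of the two lines through \<open>p\<close> whose direction \<open>v\<close> spans
  a line contained in \<^const>\<open>light_cone\<close>.\<close>

definition asymptotic_to_translated_cone ::
    "(real \<Rightarrow> real \<times> real) \<Rightarrow> real filter \<Rightarrow> bool"
  where "asymptotic_to_translated_cone \<gamma> F \<longleftrightarrow>
    (\<exists>p v. v \<noteq> 0 \<and> straight_line 0 v \<subseteq> light_cone \<and> asymptotic_to_line \<gamma> F (straight_line p v))"

text \<open>The limit of the (Euclidean unit) tangent direction; \<open>sgn w = w /\<^sub>R norm w\<close>.\<close>

definition limit_direction ::
    "(real \<Rightarrow> real \<times> real) \<Rightarrow> real filter \<Rightarrow> real \<times> real \<Rightarrow> bool"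
  where "limit_direction \<gamma> F v \<longleftrightarrow> ((\<lambda>s. sgn (vderiv \<gamma> s)) \<longlongrightarrow> v) F"

text \<open>For \<open>p \<noteq> 0\<close> on the cone there is exactly one line of the cone through \<open>p\<close>, for \<open>p = 0\<close>
  there are two.\<close>

definition tends_to_tangentially ::
    "(real \<Rightarrow> real \<times> real) \<Rightarrow> real filter \<Rightarrow> real \<times> real \<Rightarrow> bool"
  where "tends_to_tangentially \<gamma> F p \<longleftrightarrow>
    p \<in> light_cone \<and> (\<gamma> \<longlongrightarrow> p) F \<and>
    (\<exists>v. v \<noteq> 0 \<and> limit_direction \<gamma> F v \<and> straight_line p v \<subseteq> light_cone)"

definition tends_to_orthogonally ::
    "(real \<Rightarrow> real \<times> real) \<Rightarrow> real filter \<Rightarrow> real \<times> real \<Rightarrow> bool"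
  where "tends_to_orthogonally \<gamma> F p \<longleftrightarrow>
    p \<in> light_cone \<and> (\<gamma> \<longlongrightarrow> p) F \<and>
    (\<exists>v w. v \<noteq> 0 \<and> limit_direction \<gamma> F v \<and>
       w \<noteq> 0 \<and> straight_line p w \<subseteq> light_cone \<and> inner v w = 0)"

definition tends_to_origin_along_y_axis ::
    "(real \<Rightarrow> real \<times> real) \<Rightarrow> real filter \<Rightarrow> bool"
  where "tends_to_origin_along_y_axis \<gamma> F \<longleftrightarrow>
    (\<gamma> \<longlongrightarrow> 0) F \<and> (\<exists>v. v \<noteq> 0 \<and> limit_direction \<gamma> F v \<and> straight_line 0 v = y_axis)"

end

theory Submission
  imports Defs
begin

text \<open>
  A curve in \<open>\<C>\<^sup>-\<close> has polar coordinates \<open>\<gamma> = \<rho> (sinh \<theta>, cosh \<theta>)\<close>, up to the symmetry \<open>p \<mapsto> - p\<close>. Parametrize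
  a timelike curve by arc-length, pointing away from the origin, and let \<open>w\<close> be the hyperbolic
  angle from the position to the velocity, so that \<open>\<rho>' = cosh w\<close> and \<open>\<rho> \<theta>' = sinh w\<close>. The velocity
  then has hyperbolic angle \<open>\<theta> + w\<close>, whose derivative is the curvature up to sign, and
  stationarity becomes \<open>(\<theta> + w)' = - \<alpha> \<theta>'\<close>. Hence \<open>w = C - (\<alpha> + 1) \<theta>\<close>. From
  \<open>w' = - (\<alpha> + 1) \<theta>'\<close> one gets \<open>(sinh w)' = - (\<alpha> + 1) (\<rho>' / \<rho>) sinh w\<close>, so \<open>Q = \<rho>\<^bsup>\<alpha> + 1\<^esup> sinh w\<close>
  is a second constant. If \<open>Q = 0\<close> then \<open>\<theta>\<close> is constant and the curve is radial. Otherwise, for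
  \<open>\<alpha> \<noteq> -1\<close>, eliminating \<open>w\<close> gives \<open>\<rho>\<^bsup>\<alpha> + 1\<^esup> sinh (C - (\<alpha> + 1) \<theta>) = Q\<close>. A boost and possibly a reflection
  normalize \<open>C\<close> and the sign of \<open>Q\<close>, a dilation normalizes \<open>\<bar>Q\<bar>\<close>. For \<open>\<alpha> = -1\<close> the angle \<open>w\<close> is constant
  and \<open>\<rho>' / \<rho> = coth w \<cdot> \<theta>'\<close> integrates to \<open>\<rho> = e\<^bsup>c \<theta>\<^esup>\<close> up to a factor, with \<open>c = coth w\<close>.

  The proof works with an arbitrary parametrization. Stationarity is first rewritten as one identity between
  position, velocity and acceleration (lemma \<open>stationary_iff_equation\<close>), which is invariant under
  reparametrizations and similarities. This makes the converse a computation for the standard curves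
  only, and in the other direction the two constants are found in reverse order: \<open>Q\<close> by
  differentiating (lemma \<open>momentum_conserved\<close>), then the affine relation between \<open>w\<close> and \<open>\<theta>\<close> (lemma
  \<open>tilt_angle_affine\<close>).

  The ends of the standard curves are read off from two exact formulas for \<open>\<alpha> \<noteq> -1\<close>: the velocity is a
  positive multiple of \<open>(sinh (\<alpha> s), - cosh (\<alpha> s))\<close>, and, with \<open>a = \<alpha> + 1\<close>,
  \<open>\<rho>(s) e\<^bsup>s\<^esup> = ((1 - e\<^bsup>- 2 a s\<^esup>) / 2)\<^bsup>- 1 / a\<^esup>\<close>.
\<close>

section \<open>Calculus of smooth functions on open sets\<close>

text \<open>
  Smoothness in stages. Closure of \<^const>\<open>smooth\<close> under an operation is shown by induction on \<open>n\<close>,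
  since the derivative of the result is built by such operations from functions that are only
  differentiable once less.
\<close>
definition n_differentiable :: "nat \<Rightarrow> (real \<Rightarrow> 'a::real_normed_vector) \<Rightarrow> real set \<Rightarrow> bool"
  where "n_differentiable n f I \<longleftrightarrow> (\<forall>k<n. \<forall>t\<in>I. (vderiv ^^ k) f differentiable (at t))"

lemma smooth_iff_n_differentiable: "smooth f I \<longleftrightarrow> (\<forall>n. n_differentiable n f I)"
  unfolding smooth_def n_differentiable_def by blast

lemma n_differentiable_0: "n_differentiable 0 f I"
  by (simp add: n_differentiable_def)

lemma n_differentiable_Suc:
  "n_differentiable (Suc n) f I \<longleftrightarrow> (\<forall>t\<in>I. f differentiable (at t)) \<and> n_differentiable n (vderiv f) I"
  unfolding n_differentiable_def All_less_Suc2 by (simp add: funpow_Suc_right del: funpow.simps(2))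

lemma n_differentiable_SucD: "n_differentiable (Suc n) f I \<Longrightarrow> n_differentiable n f I"
  by (simp add: n_differentiable_def)

lemma vderiv_eq: "(f has_vector_derivative f') (at t) \<Longrightarrow> vderiv f t = f'"
  by (simp add: vderiv_def vector_derivative_at)

lemma has_vderiv: "f differentiable (at t) \<Longrightarrow> (f has_vector_derivative vderiv f t) (at t)"
  by (simp add: vderiv_def vector_derivative_works)

lemma n_differentiable_Suc_deriv:
  "n_differentiable (Suc n) f I \<Longrightarrow> t \<in> I \<Longrightarrow> (f has_vector_derivative vderiv f t) (at t)"
  by (simp add: n_differentiable_Suc has_vderiv)

lemma differentiable_cong_open:
  assumes "open I" "t \<in> I" "\<And>t. t \<in> I \<Longrightarrow> f t = g t"
  shows "(f has_vector_derivative d) (at t) \<longleftrightarrow> (g has_vector_derivative d) (at t)"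
  using has_vector_derivative_transform_within_open[OF _ assms(1,2), of f d g]
    has_vector_derivative_transform_within_open[OF _ assms(1,2), of g d f] assms(3) by auto

lemma vderiv_cong_open:
  assumes "open I" "t \<in> I" "\<And>t. t \<in> I \<Longrightarrow> f t = g t"
  shows "vderiv f t = vderiv g t"
  unfolding vderiv_def vector_derivative_def
  by (simp only: differentiable_cong_open[OF assms(1,2), of f g, OF assms(3)])

text \<open>
  The value of \<^const>\<open>vderiv\<close> at a point of an open set only depends on the function near that point. This is
  what allows derivatives to be replaced by formulas valid only on the set.
\<close>
lemma n_differentiable_cong:
  assumes "open I"
  shows "(\<And>t. t \<in> I \<Longrightarrow> f t = g t) \<Longrightarrow> n_differentiable n f I \<Longrightarrow> n_differentiable n g I"
proof (induction n arbitrary: f g)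
  case 0
  then show ?case by (simp add: n_differentiable_0)
next
  case (Suc n)
  have "n_differentiable n (vderiv g) I"
  proof (rule Suc.IH)
    show "vderiv f t = vderiv g t" if "t \<in> I" for t
      by (rule vderiv_cong_open[OF assms that Suc.prems(1)])
    show "n_differentiable n (vderiv f) I" using Suc.prems(2) by (simp add: n_differentiable_Suc)
  qed
  moreover have "g differentiable (at t)" if "t \<in> I" for t
  proof (rule differentiableI_vector)
    show "(g has_vector_derivative vderiv f t) (at t)"
      using n_differentiable_Suc_deriv[OF Suc.prems(2) that]
        differentiable_cong_open[OF assms that, of f g] Suc.prems(1) by simp
  qed
  ultimately show ?case by (simp add: n_differentiable_Suc)
qed

lemma n_differentiable_SucI:
  assumes "open I" and d: "\<And>t. t \<in> I \<Longrightarrow> (f has_vector_derivative f' t) (at t)" and "n_differentiable n f' I"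
  shows "n_differentiable (Suc n) f I"
proof -
  have "n_differentiable n (vderiv f) I"
    by (rule n_differentiable_cong[OF \<open>open I\<close> _ \<open>n_differentiable n f' I\<close>]) (simp add: vderiv_eq[OF d])
  with d show ?thesis by (auto simp: n_differentiable_Suc intro: differentiableI_vector)
qed

lemma n_differentiable_const: "open I \<Longrightarrow> n_differentiable n (\<lambda>t. c) I"
proof (induction n arbitrary: c)
  case (Suc n)
  show ?case by (rule n_differentiable_SucI[of _ _ "\<lambda>t. 0"]) (auto simp: Suc)
qed (simp add: n_differentiable_0)

lemma n_differentiable_id: "open I \<Longrightarrow> n_differentiable n (\<lambda>t. t) I"
proof (cases n)
  case (Suc m)
  assume "open I"
  then show ?thesis unfolding Suc
    by (intro n_differentiable_SucI[of _ _ "\<lambda>t. 1"]) (auto intro: n_differentiable_const)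
qed (simp add: n_differentiable_0)

lemma n_differentiable_add:
  assumes "open I"
  shows "n_differentiable n f I \<Longrightarrow> n_differentiable n g I \<Longrightarrow> n_differentiable n (\<lambda>t. f t + g t) I"
proof (induction n arbitrary: f g)
  case (Suc n)
  show ?case
    by (rule n_differentiable_SucI[OF assms, of _ "\<lambda>t. vderiv f t + vderiv g t"])
      (use Suc in \<open>auto simp: n_differentiable_Suc intro!: has_vector_derivative_add has_vderiv\<close>)
qed (simp add: n_differentiable_0)

lemma n_differentiable_bounded_linear:
  assumes "open I" "bounded_linear L"
  shows "n_differentiable n f I \<Longrightarrow> n_differentiable n (\<lambda>t. L (f t)) I"
proof (induction n arbitrary: f)
  case (Suc n)
  show ?case
    by (rule n_differentiable_SucI[OF assms(1), of _ "\<lambda>t. L (vderiv f t)"])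
      (use Suc in \<open>auto simp: n_differentiable_Suc
        intro!: bounded_linear.has_vector_derivative[OF assms(2)] has_vderiv\<close>)
qed (simp add: n_differentiable_0)

lemma n_differentiable_scaleR:
  assumes "open I"
  shows "n_differentiable n f I \<Longrightarrow> n_differentiable n g I \<Longrightarrow> n_differentiable n (\<lambda>t. f t *\<^sub>R g t) I"
proof (induction n arbitrary: f g)
  case (Suc n)
  note ls = Suc.prems[THEN n_differentiable_SucD]
  show ?case
  proof (rule n_differentiable_SucI[OF assms])
    fix t assume "t \<in> I"
    then show "((\<lambda>t. f t *\<^sub>R g t) has_vector_derivative f t *\<^sub>R vderiv g t + vderiv f t *\<^sub>R g t) (at t)"
      using Suc.prems[THEN n_differentiable_Suc_deriv]
      by (intro has_vector_derivative_scaleR) (auto simp: has_real_derivative_iff_has_vector_derivative)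
  next
    show "n_differentiable n (\<lambda>t. f t *\<^sub>R vderiv g t + vderiv f t *\<^sub>R g t) I"
      using Suc.prems ls by (intro n_differentiable_add[OF assms] Suc.IH) (simp_all only: n_differentiable_Suc)
  qed
qed (simp add: n_differentiable_0)

lemma n_differentiable_compose:
  assumes "open I" "g ` I \<subseteq> J"
  shows "n_differentiable n f J \<Longrightarrow> n_differentiable n g I \<Longrightarrow> n_differentiable n (\<lambda>t. f (g t)) I"
proof (induction n arbitrary: f)
  case (Suc n)
  show ?case
  proof (rule n_differentiable_SucI[OF assms(1)])
    fix t assume "t \<in> I"
    then show "((\<lambda>t. f (g t)) has_vector_derivative vderiv g t *\<^sub>R vderiv f (g t)) (at t)"
      using Suc.prems[THEN n_differentiable_Suc_deriv] assms(2)
      by (intro vector_diff_chain_at[unfolded o_def]) auto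
  next
    show "n_differentiable n (\<lambda>t. vderiv g t *\<^sub>R vderiv f (g t)) I"
      using Suc.prems n_differentiable_SucD[OF Suc.prems(2)]
      by (intro n_differentiable_scaleR[OF assms(1)] Suc.IH[of "vderiv f"]) (simp_all only: n_differentiable_Suc)
  qed
qed (simp add: n_differentiable_0)

lemma n_differentiable_inverse: "n_differentiable n (inverse :: real \<Rightarrow> real) (- {0})"
proof (induction n)
  case (Suc n)
  show ?case
  proof (rule n_differentiable_SucI)
    fix t :: real assume "t \<in> - {0}"
    then show "(inverse has_vector_derivative (-1) *\<^sub>R (inverse t *\<^sub>R inverse t)) (at t)"
      unfolding has_real_derivative_iff_has_vector_derivative[symmetric]
      by (auto intro!: derivative_eq_intros simp: power2_eq_square)
  qed (simp_all only: n_differentiable_scaleR n_differentiable_const Suc open_Compl closed_singleton)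
qed (simp add: n_differentiable_0)

lemma n_differentiable_exp: "n_differentiable n (exp :: real \<Rightarrow> real) UNIV"
proof (induction n)
  case (Suc n)
  show ?case
    by (rule n_differentiable_SucI[of _ _ exp])
      (auto simp: Suc has_real_derivative_iff_has_vector_derivative[symmetric])
qed (simp add: n_differentiable_0)

lemma n_differentiable_ln: "n_differentiable n (ln :: real \<Rightarrow> real) {0<..}"
proof (cases n)
  case (Suc m)
  have "n_differentiable m (inverse :: real \<Rightarrow> real) {0<..}"
    using n_differentiable_inverse[of m] unfolding n_differentiable_def by auto
  then show ?thesis unfolding Suc
    by (intro n_differentiable_SucI[of _ _ inverse])
      (auto simp: has_real_derivative_iff_has_vector_derivative[symmetric] field_simps
          intro!: derivative_eq_intros)
qed (simp add: n_differentiable_0)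

text \<open>
  The derivative of an inverse function is \<open>1 / (f' \<circ> g)\<close>, which contains \<open>g\<close> itself, so each order of
  differentiability of \<open>g\<close> yields the next.
\<close>
lemma n_differentiable_inverse_function:
  assumes "open J" "open I" "g ` J \<subseteq> I"
    and g: "\<And>t. t \<in> J \<Longrightarrow> (g has_vector_derivative inverse (vderiv f (g t))) (at t)"
    and f: "\<And>n. n_differentiable n f I" and nz: "\<And>t. t \<in> I \<Longrightarrow> vderiv f t \<noteq> (0::real)"
  shows "n_differentiable n g J"
proof (induction n)
  case (Suc n)
  have "n_differentiable n (vderiv f) I"
    using f[of "Suc n"] by (simp add: n_differentiable_Suc)
  then have "n_differentiable n (\<lambda>t. vderiv f (g t)) J"
    by (rule n_differentiable_compose[of J g I n "vderiv f", OF assms(1,3) _ Suc])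
  then have "n_differentiable n (\<lambda>t. inverse (vderiv f (g t))) J"
    using assms(3) nz
    by (intro n_differentiable_compose[of J "\<lambda>t. vderiv f (g t)" "-{0}" n inverse,
          OF assms(1) _ n_differentiable_inverse]) auto
  from n_differentiable_SucI[OF assms(1) g this] show ?case .
qed (simp add: n_differentiable_0)

lemma smooth_cong: "open I \<Longrightarrow> smooth f I \<Longrightarrow> (\<And>t. t \<in> I \<Longrightarrow> f t = g t) \<Longrightarrow> smooth g I"
  unfolding smooth_iff_n_differentiable by (blast intro: n_differentiable_cong)

lemma smooth_subset: "smooth f J \<Longrightarrow> I \<subseteq> J \<Longrightarrow> smooth f I"
  unfolding smooth_def by blast

lemma smooth_const: "open I \<Longrightarrow> smooth (\<lambda>t. c) I"
  and smooth_id: "open I \<Longrightarrow> smooth (\<lambda>t. t) I"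
  and smooth_add: "open I \<Longrightarrow> smooth f I \<Longrightarrow> smooth g I \<Longrightarrow> smooth (\<lambda>t. f t + g t) I"
  and smooth_scaleR:
    "open I \<Longrightarrow> smooth h I \<Longrightarrow> smooth g I \<Longrightarrow> smooth (\<lambda>t. h t *\<^sub>R g t) I"
  and smooth_bounded_linear:
    "open I \<Longrightarrow> bounded_linear L \<Longrightarrow> smooth f I \<Longrightarrow> smooth (\<lambda>t. L (f t)) I"
  by (simp_all add: smooth_iff_n_differentiable n_differentiable_const n_differentiable_id
      n_differentiable_add n_differentiable_scaleR
      n_differentiable_bounded_linear)

lemma smooth_compose:
  "open I \<Longrightarrow> smooth f J \<Longrightarrow> smooth g I \<Longrightarrow> g ` I \<subseteq> J \<Longrightarrow> smooth (\<lambda>t. f (g t)) I"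
  using n_differentiable_compose[of I g J _ f] by (simp add: smooth_iff_n_differentiable)

lemma smooth_mult:
  fixes f g :: "real \<Rightarrow> real"
  shows "open I \<Longrightarrow> smooth f I \<Longrightarrow> smooth g I \<Longrightarrow> smooth (\<lambda>t. f t * g t) I"
  using smooth_scaleR[of I f g] by simp

lemma smooth_minus: "open I \<Longrightarrow> smooth f I \<Longrightarrow> smooth (\<lambda>t. - f t) I"
  by (rule smooth_bounded_linear[OF _ bounded_linear_minus[OF bounded_linear_ident]])

lemma smooth_diff:
  "open I \<Longrightarrow> smooth f I \<Longrightarrow> smooth g I \<Longrightarrow> smooth (\<lambda>t. f t - g t) I"
  using smooth_add[of I f "\<lambda>t. - g t"] by (simp add: smooth_minus)

lemma smooth_divide:
  fixes f g :: "real \<Rightarrow> real"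
  assumes "open I" "smooth f I" "smooth g I" "\<And>t. t \<in> I \<Longrightarrow> g t \<noteq> 0"
  shows "smooth (\<lambda>t. f t / g t) I"
proof -
  have "smooth (\<lambda>t. inverse (g t)) I"
    by (rule smooth_compose[of I inverse "- {0}" g])
      (use assms in \<open>auto simp: smooth_iff_n_differentiable n_differentiable_inverse\<close>)
  then show ?thesis unfolding divide_inverse by (intro smooth_mult assms)
qed

lemma smooth_exp:
  fixes f :: "real \<Rightarrow> real" shows "open I \<Longrightarrow> smooth f I \<Longrightarrow> smooth (\<lambda>t. exp (f t)) I"
  by (rule smooth_compose[of I exp UNIV f]) (auto simp: smooth_iff_n_differentiable n_differentiable_exp)

lemma smooth_ln:
  fixes f :: "real \<Rightarrow> real"
  assumes "open I" "smooth f I" "\<And>t. t \<in> I \<Longrightarrow> f t > 0"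
  shows "smooth (\<lambda>t. ln (f t)) I"
  by (rule smooth_compose[of I ln "{0<..}" f]) (use assms in \<open>auto simp: smooth_iff_n_differentiable n_differentiable_ln\<close>)

lemma smooth_powr:
  fixes f :: "real \<Rightarrow> real"
  assumes "open I" "smooth f I" "\<And>t. t \<in> I \<Longrightarrow> f t > 0"
  shows "smooth (\<lambda>t. f t powr e) I"
proof (rule smooth_cong[OF assms(1)])
  show "smooth (\<lambda>t. exp (e * ln (f t))) I"
    by (intro smooth_exp smooth_mult smooth_const smooth_ln assms)
  show "exp (e * ln (f t)) = f t powr e" if "t \<in> I" for t
    using assms(3)[OF that] by (simp add: powr_def)
qed

lemma smooth_sinh_cosh:
  fixes f :: "real \<Rightarrow> real" assumes "open I" "smooth f I"
  shows "smooth (\<lambda>t. sinh (f t)) I" "smooth (\<lambda>t. cosh (f t)) I"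
  unfolding sinh_def cosh_def
  by (intro smooth_scaleR smooth_const smooth_add smooth_diff smooth_exp smooth_minus assms)+

lemma smooth_Pair:
  assumes "open I" "smooth f I" "smooth g I" shows "smooth (\<lambda>t. (f t, g t) :: real \<times> real) I"
proof -
  have "smooth (\<lambda>t. f t *\<^sub>R (1, 0) + g t *\<^sub>R (0, 1) :: real \<times> real) I"
    by (intro smooth_add smooth_scaleR smooth_const assms)
  then show ?thesis by simp
qed

lemma smooth_fst_snd:
  assumes "open I" "smooth f I"
  shows "smooth (\<lambda>t. fst (f t)) I" "smooth (\<lambda>t. snd (f t)) I"
  using smooth_bounded_linear[OF assms(1) _ assms(2)] bounded_linear_fst bounded_linear_snd by blast+

lemma smooth_vderiv: "smooth f I \<Longrightarrow> smooth (vderiv f) I"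
  unfolding smooth_iff_n_differentiable using n_differentiable_Suc by blast

lemma smooth_deriv: "smooth f I \<Longrightarrow> t \<in> I \<Longrightarrow> (f has_vector_derivative vderiv f t) (at t)"
  unfolding smooth_iff_n_differentiable using n_differentiable_Suc_deriv by blast

lemma smoothI_deriv:
  assumes "open I" "\<And>t. t \<in> I \<Longrightarrow> (f has_vector_derivative f' t) (at t)" "smooth f' I"
  shows "smooth f I"
  unfolding smooth_iff_n_differentiable
proof
  fix n show "n_differentiable n f I"
    using n_differentiable_SucD[OF n_differentiable_SucI[OF assms(1,2)]] assms(3)
    by (auto simp: smooth_iff_n_differentiable)
qed

lemma smooth_continuous_on: "smooth f I \<Longrightarrow> continuous_on I f"
  by (intro continuous_at_imp_continuous_on ballI has_vector_derivative_continuous[OF smooth_deriv])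

text \<open>
  A nonvanishing derivative makes \<open>f\<close> injective by the mean value theorem, and an injective continuous
  function of one variable is open.
\<close>
lemma reparametrization_image:
  assumes I: "open_interval I" and f: "smooth f I" and nz: "\<And>t. t \<in> I \<Longrightarrow> vderiv f t \<noteq> 0"
  shows "reparametrization f I (f ` I)"
proof -
  have inj: "inj_on f I"
  proof (rule linorder_inj_onI')
    fix a b assume ab: "a \<in> I" "b \<in> I" "a < b"
    then have sub: "{a..b} \<subseteq> I"
      using I mem_is_interval_1_I[of I a b] by (auto simp: open_interval_def)
    have d: "(f has_real_derivative vderiv f t) (at t)" if "t \<in> {a..b}" for t
      using smooth_deriv[OF f] that sub
      by (auto simp: has_real_derivative_iff_has_vector_derivative)
    show "f a \<noteq> f b"
    proof -
      obtain z where "a < z" "z < b" "f b - f a = (b - a) * vderiv f z"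
        using MVT2[OF ab(3), of f "vderiv f"] d by auto
      moreover from this have "vderiv f z \<noteq> 0" using sub by (intro nz) auto
      ultimately show ?thesis using ab(3) by auto
    qed
  qed
  have c: "continuous_on I f" by (rule smooth_continuous_on[OF f])
  have "open (f ` I)"
    using I by (intro injective_into_1d_imp_open_map_UNIV[OF _ c inj]) (auto simp: open_interval_def)
  moreover have "is_interval (f ` I)"
    using I connected_continuous_image[OF c] by (auto simp: open_interval_def is_interval_connected_1)
  ultimately have "open_interval (f ` I)" using I by (auto simp: open_interval_def)
  with assms inj show ?thesis by (auto simp: reparametrization_def bij_betw_def)
qed

lemma reparametrization_inverse:
  assumes r: "reparametrization f I J"
  defines "g \<equiv> the_inv_into I f"
  shows "reparametrization g J I"
    "\<And>u. u \<in> J \<Longrightarrow> (g has_vector_derivative inverse (vderiv f (g u))) (at u)"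
proof -
  from r have I: "open I" "open J" and f: "smooth f I" and nz: "\<And>t. t \<in> I \<Longrightarrow> vderiv f t \<noteq> 0"
    and bij: "bij_betw f I J"
    by (auto simp: reparametrization_def open_interval_def)
  have bg: "bij_betw g J I" unfolding g_def using bij by (rule bij_betw_the_inv_into)
  have gf: "g (f t) = t" if "t \<in> I" for t
    unfolding g_def using bij that by (simp add: bij_betw_def the_inv_into_f_f)
  have fg: "f (g u) = u" if "u \<in> J" for u
    unfolding g_def using bij that by (simp add: bij_betw_def f_the_inv_into_f)
  show d: "(g has_vector_derivative inverse (vderiv f (g u))) (at u)" if "u \<in> J" for u
  proof -
    have gu: "g u \<in> I" using bg that by (auto simp: bij_betw_def)
    have "(g has_derivative (\<lambda>x. inverse (vderiv f (g u)) * x)) (at (f (g u)))"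
      by (rule has_derivative_inverse_strong[OF I(1) gu smooth_continuous_on[OF f] gf,
            of "\<lambda>x. x * vderiv f (g u)"])
        (use smooth_deriv[OF f gu] nz[OF gu] in \<open>auto simp: has_vector_derivative_def fun_eq_iff\<close>)
    then show ?thesis
      using fg[OF that] by (simp add: has_vector_derivative_def mult.commute)
  qed
  have "smooth g J"
    unfolding smooth_iff_n_differentiable
    by (intro allI n_differentiable_inverse_function[of J I g f])
      (use I d f nz bg in \<open>auto simp: smooth_iff_n_differentiable bij_betw_def\<close>)
  with r bg nz show "reparametrization g J I"
    by (auto simp: reparametrization_def vderiv_eq[OF d] bij_betw_def)
qed

text \<open>
  The integral of a continuous function over an open interval with possibly infinite end points
  is available once the interval is written with extended real end points.
\<close>
lemma open_interval_antiderivative: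
  assumes I: "open_interval I" and f: "smooth (f :: real \<Rightarrow> real) I"
  obtains F where "\<And>t. t \<in> I \<Longrightarrow> (F has_vector_derivative f t) (at t)"
proof -
  have in_iff: "t \<in> I \<longleftrightarrow> (INF x\<in>I. ereal x) < ereal t \<and> ereal t < (SUP x\<in>I. ereal x)" for t
  proof
    assume "t \<in> I"
    then obtain e where e: "e > 0" "ball t e \<subseteq> I"
      using I by (metis open_interval_def open_contains_ball)
    then have "t - e/2 \<in> I" "t + e/2 \<in> I" by (auto simp: dist_real_def subset_iff)
    with e(1) show "(INF x\<in>I. ereal x) < ereal t \<and> ereal t < (SUP x\<in>I. ereal x)"
      unfolding INF_less_iff less_SUP_iff by (intro conjI bexI[of _ "t - e/2"] bexI[of _ "t + e/2"]) auto
  next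
    assume "(INF x\<in>I. ereal x) < ereal t \<and> ereal t < (SUP x\<in>I. ereal x)"
    then obtain x y where "x \<in> I" "y \<in> I" "x < t" "t < y"
      by (auto simp: INF_less_iff less_SUP_iff)
    with I show "t \<in> I"
      using mem_is_interval_1_I[of I x y t] by (simp add: open_interval_def)
  qed
  have "(INF x\<in>I. ereal x) < (SUP x\<in>I. ereal x)"
  proof -
    obtain t where "t \<in> I" using I by (auto simp: open_interval_def)
    then show ?thesis using in_iff[of t] by (meson less_trans)
  qed
  moreover have "isCont f x" if "x \<in> I" for x
    using smooth_deriv[OF f that] by (rule has_vector_derivative_continuous)
  ultimately obtain F where
    "\<forall>x. (INF x\<in>I. ereal x) < ereal x \<longrightarrow> ereal x < (SUP x\<in>I. ereal x) \<longrightarrow>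
      (F has_vector_derivative f x) (at x)"
    using einterval_antiderivative[of "INF x\<in>I. ereal x" "SUP x\<in>I. ereal x" f] in_iff by blast
  then show thesis by (intro that[of F]) (use in_iff in blast)
qed

section \<open>Stationarity as an identity for an arbitrary parametrization\<close>

text \<open>
  The determinant. Since \<open>area\<close> of \<open>v\<close> and \<open>q\<close> is, up to sign, the Lorentz product of \<open>q\<close> with the vector
  obtained from \<open>v\<close> by exchanging its coordinates, which is orthogonal to \<open>v\<close>, it replaces the normal field.
\<close>
definition area :: "real \<times> real \<Rightarrow> real \<times> real \<Rightarrow> real"
  where "area p q = fst p * snd q - snd p * fst q"

text \<open>
  The curvature equation for position \<open>p\<close>, velocity \<open>v\<close> and acceleration \<open>a\<close>, with the unit normal expressed
  through \<open>v\<close> and the denominators cleared. Both \<open>lor p p\<close> and \<open>lor v v\<close> are negative for the curves considered,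
  which accounts for the sign.
\<close>
definition stationary_equation ::
    "real \<Rightarrow> real \<times> real \<Rightarrow> real \<times> real \<Rightarrow> real \<times> real \<Rightarrow> bool"
  where "stationary_equation \<alpha> p v a \<longleftrightarrow> area v a * lor p p = \<alpha> * area v p * lor v v"

lemma lor_scaleR: "lor (k *\<^sub>R p) (k *\<^sub>R q) = k\<^sup>2 * lor p q"
  by (simp add: lor_def power2_eq_square algebra_simps)

text \<open>
  Both sides scale by \<open>k\<^sup>3\<close>, and the tangential part of the acceleration is not seen by \<open>area\<close>.
\<close>
lemma stationary_equation_reparametrization:
  assumes "k \<noteq> 0"
  shows "stationary_equation \<alpha> p (k *\<^sub>R v) (k\<^sup>2 *\<^sub>R a + m *\<^sub>R v) \<longleftrightarrow> stationary_equation \<alpha> p v a"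
proof -
  have "area (k *\<^sub>R v) (k\<^sup>2 *\<^sub>R a + m *\<^sub>R v) * lor p p = k ^ 3 * (area v a * lor p p)"
    by (simp add: area_def power2_eq_square power3_eq_cube algebra_simps)
  moreover have "\<alpha> * area (k *\<^sub>R v) p * lor (k *\<^sub>R v) (k *\<^sub>R v) = k ^ 3 * (\<alpha> * area v p * lor v v)"
    by (simp add: area_def lor_def power2_eq_square power3_eq_cube algebra_simps)
  ultimately show ?thesis
    unfolding stationary_equation_def using assms by (simp only: mult_cancel_left) simp
qed

lemma area_linear:
  assumes "linear T"
  shows "area (T p) (T q) = area (T (1, 0)) (T (0, 1)) * area p q"
proof -
  have "T p = fst p *\<^sub>R T (1, 0) + snd p *\<^sub>R T (0, 1)" for p
    using linear_add[OF assms, of "fst p *\<^sub>R (1, 0)" "snd p *\<^sub>R (0, 1)"]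
    by (simp add: linear_scale[OF assms, symmetric])
  from this[of p] this[of q] show ?thesis
    by (simp add: area_def algebra_simps)
qed

text \<open>
  Velocities of the form \<open>g u\<close> with a simple direction \<open>u\<close> enter the identity through \<open>u\<close> and
  \<open>u' = w\<close> alone, without the derivative \<open>m\<close> of the factor \<open>g\<close>, as \<open>area u u = 0\<close>.
\<close>
lemma stationary_equation_factors:
  "stationary_equation \<alpha> (r *\<^sub>R e) (g *\<^sub>R u) (g *\<^sub>R w + m *\<^sub>R u) \<longleftrightarrow>
    g\<^sup>2 * area u w * (r\<^sup>2 * lor e e) = \<alpha> * (g ^ 3 * r * area u e * lor u u)"
proof -
  have "area (g *\<^sub>R u) (g *\<^sub>R w + m *\<^sub>R u) = g\<^sup>2 * area u w"
    "area (g *\<^sub>R u) (r *\<^sub>R e) = g * r * area u e"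
    by (simp_all add: area_def power2_eq_square algebra_simps)
  then show ?thesis
    by (simp add: stationary_equation_def lor_scaleR power2_eq_square power3_eq_cube mult_ac)
qed

text \<open>
  A linear isometry preserves \<^const>\<open>lor\<close> and multiplies \<^const>\<open>area\<close> by its determinant, which occurs once on each
  side.
\<close>
lemma stationary_equation_similarity:
  assumes T: "linear_isometry T" and eq: "stationary_equation \<alpha> p v a"
  shows "stationary_equation \<alpha> (\<mu> *\<^sub>R T p) (\<mu> *\<^sub>R T v) (\<mu> *\<^sub>R T a)"
proof -
  have l: "lor (\<mu> *\<^sub>R T q) (\<mu> *\<^sub>R T q) = \<mu>\<^sup>2 * lor q q" for q
    using T by (simp only: linear_isometry_def lor_scaleR)
  have "area (\<mu> *\<^sub>R T q) (\<mu> *\<^sub>R T r) = \<mu>\<^sup>2 * (area (T (1, 0)) (T (0, 1)) * area q r)" for q r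
  proof -
    have "area (\<mu> *\<^sub>R T q) (\<mu> *\<^sub>R T r) = \<mu>\<^sup>2 * area (T q) (T r)"
      by (simp add: area_def power2_eq_square algebra_simps)
    then show ?thesis using T area_linear[of T q r] by (simp only: linear_isometry_def)
  qed
  with eq show ?thesis unfolding stationary_equation_def l by (simp add: algebra_simps)
qed

text \<open>
  The only unit normals to the unit vector \<open>v\<close> are \<open>\<plusminus>\<close> the vector obtained by exchanging the coordinates of \<open>v\<close>.
  The sign \<open>k\<close> cancels.
\<close>
lemma unit_normal_curvature_iff:
  assumes v: "lor v v = -1" and p: "lor p p < 0"
    and N: "lor n v = 0" "\<bar>lor n n\<bar> = 1"
  shows "- lor n a = - \<alpha> * (lor n p / \<bar>lor p p\<bar>) \<longleftrightarrow> stationary_equation \<alpha> p v a"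
proof -
  define k where "k = fst n / snd v"
  have v2: "snd v \<noteq> 0"
  proof
    assume "snd v = 0"
    then have "fst v * fst v = -1" using v by (simp add: lor_def)
    then show False using zero_le_square[of "fst v"] by linarith
  qed
  have n: "fst n = k * snd v" "snd n = k * fst v"
    using N(1) v2 by (auto simp: k_def lor_def field_simps)
  have "lor n n = - k\<^sup>2 * lor v v"
    by (simp add: lor_def n power2_eq_square algebra_simps)
  then have "k\<^sup>2 = 1" using N(2) v by simp
  then have k: "k \<noteq> 0" by auto
  have "lor n q = - k * area v q" for q
    by (simp add: lor_def area_def n algebra_simps)
  then have "- lor n a = - \<alpha> * (lor n p / \<bar>lor p p\<bar>) \<longleftrightarrow>
      k * (area v a * lor p p) = k * (\<alpha> * area v p * lor v v)"
    using p by (simp add: v field_simps)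
  then show ?thesis using k by (simp only: stationary_equation_def mult_cancel_left) simp
qed

lemma vderiv_compose:
  assumes "open I" "open J" "smooth f J" "smooth g I" "g ` I \<subseteq> J" "t \<in> I"
  shows "vderiv (\<lambda>t. f (g t)) t = vderiv g t *\<^sub>R vderiv f (g t)"
    and "vderiv (vderiv (\<lambda>t. f (g t))) t =
      (vderiv g t)\<^sup>2 *\<^sub>R vderiv (vderiv f) (g t) + vderiv (vderiv g) t *\<^sub>R vderiv f (g t)"
proof -
  have chain: "((\<lambda>t. h (g t)) has_vector_derivative vderiv g t *\<^sub>R vderiv h (g t)) (at t)"
    if "smooth h J" "t \<in> I" for h :: "real \<Rightarrow> 'a" and t
    using smooth_deriv[OF assms(4) that(2)] smooth_deriv[OF that(1), of "g t"] assms(5) that(2)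
    by (intro vector_diff_chain_at[unfolded o_def]) auto
  have d1: "vderiv (\<lambda>t. f (g t)) t = vderiv g t *\<^sub>R vderiv f (g t)" if "t \<in> I" for t
    by (rule vderiv_eq[OF chain[OF assms(3) that]])
  show "vderiv (\<lambda>t. f (g t)) t = vderiv g t *\<^sub>R vderiv f (g t)"
    by (rule d1[OF assms(6)])
  have "(vderiv g has_real_derivative vderiv (vderiv g) t) (at t)"
    using smooth_deriv[OF smooth_vderiv[OF assms(4)] assms(6)]
    by (simp add: has_real_derivative_iff_has_vector_derivative)
  from has_vector_derivative_scaleR[OF this chain[OF smooth_vderiv[OF assms(3)] assms(6)]]
  have "vderiv (\<lambda>t. vderiv g t *\<^sub>R vderiv f (g t)) t =
      (vderiv g t)\<^sup>2 *\<^sub>R vderiv (vderiv f) (g t) + vderiv (vderiv g) t *\<^sub>R vderiv f (g t)"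
    by (simp add: vderiv_eq power2_eq_square)
  then show "vderiv (vderiv (\<lambda>t. f (g t))) t =
      (vderiv g t)\<^sup>2 *\<^sub>R vderiv (vderiv f) (g t) + vderiv (vderiv g) t *\<^sub>R vderiv f (g t)"
    using vderiv_cong_open[OF assms(1,6) d1] by simp
qed

text \<open>
  The arc-length is an antiderivative of the Lorentzian speed, and its inverse is the required parameter
  change.
\<close>
lemma timelike_arc_length_reparametrization:
  assumes \<gamma>: "regular_curve \<gamma> I" "timelike \<gamma> I"
  obtains \<phi> J where "reparametrization \<phi> J I" "arc_length (\<gamma> \<circ> \<phi>) J"
proof -
  have I: "open_interval I" "open I" and sm: "smooth \<gamma> I"
    using \<gamma> by (auto simp: regular_curve_def open_interval_def)
  define V where "V = (\<lambda>t. (- lor (vderiv \<gamma> t) (vderiv \<gamma> t)) powr (1/2))"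
  have pos: "- lor (vderiv \<gamma> t) (vderiv \<gamma> t) > 0" if "t \<in> I" for t
    using \<gamma>(2) that by (simp add: timelike_def)
  then have Vpos: "V t > 0" if "t \<in> I" for t
    unfolding V_def using pos[OF that] by simp
  have "smooth (\<lambda>t. - lor (vderiv \<gamma> t) (vderiv \<gamma> t)) I"
    unfolding lor_def
    by (intro smooth_minus smooth_diff smooth_mult smooth_fst_snd smooth_vderiv sm I(2))
  then have V: "smooth V I" unfolding V_def using pos by (rule smooth_powr[OF I(2)])
  from open_interval_antiderivative[OF I(1) V] obtain L where
    L: "\<And>t. t \<in> I \<Longrightarrow> (L has_vector_derivative V t) (at t)" by blast
  have sL: "smooth L I" by (rule smoothI_deriv[OF I(2) L V])
  have r: "reparametrization L I (L ` I)"
    by (rule reparametrization_image[OF I(1) sL]) (use Vpos vderiv_eq[OF L] in force)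
  define \<phi> where "\<phi> = the_inv_into I L"
  note inv = reparametrization_inverse[OF r, folded \<phi>_def]
  have "\<bar>lor (vderiv (\<gamma> \<circ> \<phi>) u) (vderiv (\<gamma> \<circ> \<phi>) u)\<bar> = 1" if u: "u \<in> L ` I" for u
  proof -
    have \<phi>u: "\<phi> u \<in> I" using inv(1) u by (auto simp: reparametrization_def bij_betw_def)
    have "vderiv (\<gamma> \<circ> \<phi>) u = vderiv \<phi> u *\<^sub>R vderiv \<gamma> (\<phi> u)"
      unfolding o_def
      by (rule vderiv_compose(1)[of "L ` I" I])
        (use inv(1) I(2) sm u in \<open>auto simp: reparametrization_def bij_betw_def open_interval_def\<close>)
    also have "vderiv \<phi> u = inverse (V (\<phi> u))"
      using vderiv_eq[OF inv(2)[OF u]] vderiv_eq[OF L[OF \<phi>u]] by simp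
    finally have "lor (vderiv (\<gamma> \<circ> \<phi>) u) (vderiv (\<gamma> \<circ> \<phi>) u) =
        (inverse (V (\<phi> u)))\<^sup>2 * lor (vderiv \<gamma> (\<phi> u)) (vderiv \<gamma> (\<phi> u))"
      by (simp only: lor_scaleR)
    moreover have "(V (\<phi> u))\<^sup>2 = - lor (vderiv \<gamma> (\<phi> u)) (vderiv \<gamma> (\<phi> u))"
      using pos[OF \<phi>u] unfolding V_def by (simp add: powr_half_sqrt)
    ultimately show ?thesis using pos[OF \<phi>u] by (simp add: power_inverse field_simps)
  qed
  then show thesis using that inv(1) by (auto simp: arc_length_def)
qed

text \<open>
  From left to right, each unit normal of the given arc-length parametrization yields the identity. From right to left
  an arc-length parametrization exists, and exchanging the coordinates of its velocity gives a smooth unit normal field.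
\<close>
lemma stationary_iff_equation:
  assumes \<gamma>: "regular_curve \<gamma> I" "timelike \<gamma> I" "\<gamma> ` I \<subseteq> neg_region"
  shows "stationary \<alpha> \<gamma> I \<longleftrightarrow>
    (\<forall>t\<in>I. stationary_equation \<alpha> (\<gamma> t) (vderiv \<gamma> t) (vderiv (vderiv \<gamma>) t))"
proof -
  have I: "open_interval I" "open I" and sm: "smooth \<gamma> I"
    using \<gamma> by (auto simp: regular_curve_def open_interval_def)
  have arc: "lor (vderiv (\<gamma> \<circ> \<phi>) u) (vderiv (\<gamma> \<circ> \<phi>) u) = -1"
      "(\<And>n. lor n (vderiv (\<gamma> \<circ> \<phi>) u) = 0 \<Longrightarrow> \<bar>lor n n\<bar> = 1 \<Longrightarrow>
        - lor n (vderiv (vderiv (\<gamma> \<circ> \<phi>)) u) =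
          - \<alpha> * (lor n (\<gamma> (\<phi> u)) / \<bar>lor (\<gamma> (\<phi> u)) (\<gamma> (\<phi> u))\<bar>) \<longleftrightarrow>
        stationary_equation \<alpha> (\<gamma> (\<phi> u)) (vderiv \<gamma> (\<phi> u)) (vderiv (vderiv \<gamma>) (\<phi> u)))"
    if \<phi>: "reparametrization \<phi> J I" "arc_length (\<gamma> \<circ> \<phi>) J" and u: "u \<in> J" for J \<phi> u
  proof -
    have J: "open J" "smooth \<phi> J" "\<phi> ` J \<subseteq> I" and nz: "vderiv \<phi> u \<noteq> 0"
      using \<phi>(1) u by (auto simp: reparametrization_def open_interval_def bij_betw_def)
    have \<phi>u: "\<phi> u \<in> I" using J(3) u by blast
    note d = vderiv_compose[OF J(1) I(2) sm J(2,3) u, folded o_def]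
    have "lor (vderiv (\<gamma> \<circ> \<phi>) u) (vderiv (\<gamma> \<circ> \<phi>) u) < 0"
      unfolding d lor_scaleR using \<gamma>(2) \<phi>u nz by (simp add: timelike_def mult_pos_neg)
    moreover have "\<bar>lor (vderiv (\<gamma> \<circ> \<phi>) u) (vderiv (\<gamma> \<circ> \<phi>) u)\<bar> = 1"
      using \<phi>(2) u by (simp add: arc_length_def)
    ultimately show v: "lor (vderiv (\<gamma> \<circ> \<phi>) u) (vderiv (\<gamma> \<circ> \<phi>) u) = -1" by linarith
    have p: "lor (\<gamma> (\<phi> u)) (\<gamma> (\<phi> u)) < 0" using \<gamma>(3) \<phi>u by (auto simp: neg_region_def)
    show "- lor n (vderiv (vderiv (\<gamma> \<circ> \<phi>)) u) =
          - \<alpha> * (lor n (\<gamma> (\<phi> u)) / \<bar>lor (\<gamma> (\<phi> u)) (\<gamma> (\<phi> u))\<bar>) \<longleftrightarrow>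
        stationary_equation \<alpha> (\<gamma> (\<phi> u)) (vderiv \<gamma> (\<phi> u)) (vderiv (vderiv \<gamma>) (\<phi> u))"
      if "lor n (vderiv (\<gamma> \<circ> \<phi>) u) = 0" "\<bar>lor n n\<bar> = 1" for n
      using unit_normal_curvature_iff[OF v p that] stationary_equation_reparametrization[OF nz]
      unfolding d by blast
  qed
  show ?thesis
  proof
    assume "stationary \<alpha> \<gamma> I"
    then obtain J \<phi> N where \<phi>: "reparametrization \<phi> J I" "arc_length (\<gamma> \<circ> \<phi>) J"
      and N: "unit_normal_field (\<gamma> \<circ> \<phi>) J N"
      and c: "\<forall>t\<in>J. curvature (\<gamma> \<circ> \<phi>) N t =
         - \<alpha> * (lor (N t) (\<gamma> (\<phi> t)) / \<bar>lor (\<gamma> (\<phi> t)) (\<gamma> (\<phi> t))\<bar>)"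
      unfolding stationary_def by blast
    have "stationary_equation \<alpha> (\<gamma> (\<phi> u)) (vderiv \<gamma> (\<phi> u)) (vderiv (vderiv \<gamma>) (\<phi> u))"
      if "u \<in> J" for u
      using arc(2)[OF \<phi> that, of "N u"] N c that by (simp add: unit_normal_field_def curvature_def)
    moreover have "I = \<phi> ` J" using \<phi>(1) by (auto simp: reparametrization_def bij_betw_def)
    ultimately show "\<forall>t\<in>I. stationary_equation \<alpha> (\<gamma> t) (vderiv \<gamma> t) (vderiv (vderiv \<gamma>) t)"
      by blast
  next
    assume eq: "\<forall>t\<in>I. stationary_equation \<alpha> (\<gamma> t) (vderiv \<gamma> t) (vderiv (vderiv \<gamma>) t)"
    obtain \<phi> J where \<phi>: "reparametrization \<phi> J I" "arc_length (\<gamma> \<circ> \<phi>) J"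
      using timelike_arc_length_reparametrization[OF \<gamma>(1,2)] .
    have J: "open J" "smooth \<phi> J" "\<phi> ` J \<subseteq> I"
      using \<phi>(1) by (auto simp: reparametrization_def open_interval_def bij_betw_def)
    define N where "N = (\<lambda>u. (snd (vderiv (\<gamma> \<circ> \<phi>) u), fst (vderiv (\<gamma> \<circ> \<phi>) u)))"
    have "smooth (\<gamma> \<circ> \<phi>) J"
      unfolding o_def by (rule smooth_compose[OF J(1) sm J(2,3)])
    then have "smooth N J"
      unfolding N_def by (intro smooth_Pair smooth_fst_snd smooth_vderiv J)
    moreover have N: "lor (N u) (vderiv (\<gamma> \<circ> \<phi>) u) = 0" "\<bar>lor (N u) (N u)\<bar> = 1" if "u \<in> J" for u
      using arc(1)[OF \<phi> that] by (auto simp: N_def lor_def)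
    ultimately have "unit_normal_field (\<gamma> \<circ> \<phi>) J N"
      by (simp add: unit_normal_field_def)
    moreover have "curvature (\<gamma> \<circ> \<phi>) N u =
         - \<alpha> * (lor (N u) (\<gamma> (\<phi> u)) / \<bar>lor (\<gamma> (\<phi> u)) (\<gamma> (\<phi> u))\<bar>)" if "u \<in> J" for u
      unfolding curvature_def using arc(2)[OF \<phi> that N[OF that]] eq J(3) that by blast
    moreover have "\<gamma> ` I \<inter> light_cone = {}"
      using \<gamma>(3) by (force simp: neg_region_def light_cone_def)
    ultimately show "stationary \<alpha> \<gamma> I"
      unfolding stationary_def using \<gamma>(1,2) \<phi> by blast
  qed
qed

section \<open>The explicit curves are stationary\<close>

lemma open_std_domain: "open (std_domain \<alpha>)"
  unfolding std_domain_def by (auto intro!: open_Collect_less continuous_intros)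

lemma std_radius_pos: "s \<in> std_domain \<alpha> \<Longrightarrow> std_radius \<alpha> c s > 0"
  by (auto simp: std_domain_def std_radius_def)

lemma smooth_std_radius: "smooth (std_radius \<alpha> c) (std_domain \<alpha>)"
proof (cases "\<alpha> = -1")
  case True
  then show ?thesis
    unfolding std_radius_def std_domain_def by (simp add: smooth_exp smooth_mult smooth_const smooth_id)
next
  case False
  have "smooth (\<lambda>s. sinh ((\<alpha> + 1) * s) powr (- 1 / (\<alpha> + 1))) (std_domain \<alpha>)"
    using False
    by (intro smooth_powr smooth_sinh_cosh smooth_mult smooth_const smooth_id open_std_domain)
      (simp add: std_domain_def)
  with False show ?thesis by (simp add: std_radius_def[abs_def])
qed

lemma smooth_std_curve: "smooth (std_curve \<alpha> c) (std_domain \<alpha>)"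
  unfolding std_curve_def[abs_def]
  by (intro smooth_scaleR[where g = "\<lambda>s. (sinh s, cosh s)"] smooth_std_radius smooth_Pair
      smooth_sinh_cosh smooth_id open_std_domain)

lemma lor_std_curve: "lor (std_curve \<alpha> c s) (std_curve \<alpha> c s) = - (std_radius \<alpha> c s)\<^sup>2"
proof -
  have "lor (sinh s, cosh s) (sinh s, cosh s) = - 1"
    using cosh_square_eq[of s] by (simp add: lor_def power2_eq_square)
  then show ?thesis by (simp add: std_curve_def lor_scaleR del: scaleR_Pair)
qed

text \<open>
  From \<open>\<rho>' = - \<rho> coth ((\<alpha> + 1) s)\<close> the components of \<open>\<gamma>'\<close> become \<open>sinh\<close> and \<open>cosh\<close> of the difference
  \<open>(\<alpha> + 1) s - s = \<alpha> s\<close>: the velocity turns at the constant rate \<open>\<alpha>\<close> in \<open>s\<close>. Stationarity and the limit directions at the ends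
  follow from this formula.
\<close>
lemma vderiv_std_curve:
  assumes "\<alpha> \<noteq> -1" "s \<in> std_domain \<alpha>"
  shows "vderiv (std_curve \<alpha> c) s =
    (std_radius \<alpha> c s / sinh ((\<alpha> + 1) * s)) *\<^sub>R (sinh (\<alpha> * s), - cosh (\<alpha> * s))"
proof (rule vderiv_eq)
  define a where "a = \<alpha> + 1"
  have a: "a \<noteq> 0" "sinh (a * s) > 0" using assms by (auto simp: a_def std_domain_def)
  have r: "(std_radius \<alpha> c has_real_derivative - std_radius \<alpha> c s * cosh (a * s) / sinh (a * s)) (at s)"
  proof (rule has_field_derivative_transform_within_open[OF _ open_std_domain assms(2)])
    show "((\<lambda>s. exp (- 1 / a * ln (sinh (a * s)))) has_real_derivative
        - std_radius \<alpha> c s * cosh (a * s) / sinh (a * s)) (at s)"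
      using a assms(1) by (auto intro!: derivative_eq_intros simp: std_radius_def a_def powr_def)
    show "exp (- 1 / a * ln (sinh (a * x))) = std_radius \<alpha> c x" if "x \<in> std_domain \<alpha>" for x
      using that assms(1) by (auto simp: std_radius_def a_def powr_def std_domain_def)
  qed
  have e: "\<alpha> * s = a * s - s" by (simp add: a_def algebra_simps)
  have field: "- r * C / S * x + y * r = r / S * (S * y - C * x)" if "S > 0" for r C S x y :: real
    using that by (simp add: field_simps)
  have sh: "(sinh has_real_derivative cosh s) (at s)"
    and ch: "(cosh has_real_derivative sinh s) (at s)"
    by (auto intro!: derivative_eq_intros)
  have "((\<lambda>s. std_radius \<alpha> c s * sinh s) has_real_derivative
      std_radius \<alpha> c s / sinh (a * s) * sinh (\<alpha> * s)) (at s)"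
    using DERIV_mult[OF r sh] unfolding field[OF a(2)] e sinh_diff .
  moreover have "((\<lambda>s. std_radius \<alpha> c s * cosh s) has_real_derivative
      - (std_radius \<alpha> c s / sinh (a * s) * cosh (\<alpha> * s))) (at s)"
    using DERIV_mult[OF r ch]
    by (simp only: field[OF a(2)] e cosh_diff minus_diff_eq flip: mult_minus_right)
  ultimately have "((\<lambda>s. (std_radius \<alpha> c s * sinh s, std_radius \<alpha> c s * cosh s)) has_vector_derivative
      (std_radius \<alpha> c s / sinh (a * s) * sinh (\<alpha> * s),
        - (std_radius \<alpha> c s / sinh (a * s) * cosh (\<alpha> * s)))) (at s)"
    by (intro has_vector_derivative_Pair) (simp_all add: has_real_derivative_iff_has_vector_derivative)
  then show "(std_curve \<alpha> c has_vector_derivative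
      (std_radius \<alpha> c s / sinh ((\<alpha> + 1) * s)) *\<^sub>R (sinh (\<alpha> * s), - cosh (\<alpha> * s))) (at s)"
    by (simp add: std_curve_def[abs_def] a_def)
qed

lemma vderiv_std_curve_exp:
  "vderiv (std_curve (-1) c) s = exp (c * s) *\<^sub>R (c * sinh s + cosh s, c * cosh s + sinh s)"
proof (rule vderiv_eq)
  have "((\<lambda>s. (exp (c * s) * sinh s, exp (c * s) * cosh s)) has_vector_derivative
      (exp (c * s) * (c * sinh s + cosh s), exp (c * s) * (c * cosh s + sinh s))) (at s)"
    by (intro has_vector_derivative_Pair;
        unfold has_real_derivative_iff_has_vector_derivative[symmetric])
      (auto intro!: derivative_eq_intros simp: algebra_simps)
  then show "(std_curve (-1) c has_vector_derivative
      exp (c * s) *\<^sub>R (c * sinh s + cosh s, c * cosh s + sinh s)) (at s)"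
    by (simp add: std_curve_def[abs_def] std_radius_def)
qed

lemma std_curve_timelike:
  assumes "\<alpha> = -1 \<longrightarrow> c\<^sup>2 > 1" "s \<in> std_domain \<alpha>"
  shows "lor (vderiv (std_curve \<alpha> c) s) (vderiv (std_curve \<alpha> c) s) < 0"
proof (cases "\<alpha> = -1")
  case True
  have "lor (c * sinh s + cosh s, c * cosh s + sinh s) (c * sinh s + cosh s, c * cosh s + sinh s) =
      (c\<^sup>2 - 1) * ((sinh s)\<^sup>2 - (cosh s)\<^sup>2)"
    by (simp add: lor_def power2_eq_square algebra_simps)
  also have "\<dots> = 1 - c\<^sup>2" by (simp add: cosh_square_eq)
  finally have "lor (vderiv (std_curve \<alpha> c) s) (vderiv (std_curve \<alpha> c) s) =
      (exp (c * s))\<^sup>2 * (1 - c\<^sup>2)"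
    by (simp only: True vderiv_std_curve_exp lor_scaleR)
  also have "\<dots> < 0" by (rule mult_pos_neg) (use assms(1) True in auto)
  finally show ?thesis .
next
  case False
  have "lor (sinh (\<alpha> * s), - cosh (\<alpha> * s)) (sinh (\<alpha> * s), - cosh (\<alpha> * s)) = -1"
    using cosh_square_eq[of "\<alpha> * s"] by (simp add: lor_def power2_eq_square)
  then show ?thesis
    using False assms(2) std_radius_pos[OF assms(2), of c]
    by (auto simp: vderiv_std_curve lor_scaleR std_domain_def simp del: scaleR_Pair)
qed

lemma std_curve_stationary_equation:
  assumes s: "s \<in> std_domain \<alpha>"
  shows "stationary_equation \<alpha> (std_curve \<alpha> c s) (vderiv (std_curve \<alpha> c) s)
    (vderiv (vderiv (std_curve \<alpha> c)) s)"
proof (cases "\<alpha> = -1")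
  case True
  define u where "u = (\<lambda>s. (c * sinh s + cosh s, c * cosh s + sinh s))"
  define w where "w = (c * cosh s + sinh s, c * sinh s + cosh s)"
  have du: "(u has_vector_derivative w) (at s)"
    unfolding u_def w_def
    by (intro has_vector_derivative_Pair;
        unfold has_real_derivative_iff_has_vector_derivative[symmetric])
      (auto intro!: derivative_eq_intros simp: algebra_simps)
  have "((\<lambda>s. exp (c * s) *\<^sub>R u s) has_vector_derivative
      exp (c * s) *\<^sub>R w + (exp (c * s) * c) *\<^sub>R u s) (at s)"
    by (rule has_vector_derivative_scaleR[OF _ du]) (auto intro!: derivative_eq_intros)
  moreover have v: "vderiv (std_curve (-1) c) = (\<lambda>s. exp (c * s) *\<^sub>R u s)"
    by (rule ext) (simp only: vderiv_std_curve_exp u_def)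
  ultimately have a: "vderiv (vderiv (std_curve (-1) c)) s =
      exp (c * s) *\<^sub>R w + (exp (c * s) * c) *\<^sub>R u s"
    by (simp only: v vderiv_eq)
  have "cosh s * cosh s = sinh s * sinh s + 1"
    using cosh_square_eq[of s] by (simp add: power2_eq_square)
  then have "area (u s) w = 1 - c\<^sup>2" "lor (u s) (u s) = 1 - c\<^sup>2"
    "area (u s) (sinh s, cosh s) = 1" "lor (sinh s, cosh s) (sinh s, cosh s) = -1"
    by (simp_all add: area_def lor_def u_def w_def power2_eq_square algebra_simps)
  then have "stationary_equation \<alpha> (exp (c * s) *\<^sub>R (sinh s, cosh s)) (exp (c * s) *\<^sub>R u s)
      (exp (c * s) *\<^sub>R w + (exp (c * s) * c) *\<^sub>R u s)"
    unfolding stationary_equation_factors by (simp add: True power2_eq_square power3_eq_cube)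
  then show ?thesis
    using a by (simp add: True v std_curve_def std_radius_def del: scaleR_Pair)
next
  case False
  define g where "g = (\<lambda>s. std_radius \<alpha> c s / sinh ((\<alpha> + 1) * s))"
  define u where "u = (\<lambda>s. (sinh (\<alpha> * s), - cosh (\<alpha> * s)))"
  define w where "w = (\<alpha> * cosh (\<alpha> * s), - \<alpha> * sinh (\<alpha> * s))"
  have sh: "sinh ((\<alpha> + 1) * s) \<noteq> 0" if "s \<in> std_domain \<alpha>" for s
    using that False by (auto simp: std_domain_def)
  have "smooth g (std_domain \<alpha>)"
    unfolding g_def
    by (intro smooth_divide smooth_std_radius smooth_sinh_cosh smooth_mult smooth_const smooth_id
        open_std_domain) (rule sh)
  from smooth_deriv[OF this s] have "(g has_real_derivative vderiv g s) (at s)"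
    by (simp add: has_real_derivative_iff_has_vector_derivative)
  moreover have "(u has_vector_derivative w) (at s)"
    unfolding u_def w_def
    by (intro has_vector_derivative_Pair;
        unfold has_real_derivative_iff_has_vector_derivative[symmetric])
      (auto intro!: derivative_eq_intros simp: algebra_simps)
  ultimately have "vderiv (\<lambda>s. g s *\<^sub>R u s) s = g s *\<^sub>R w + vderiv g s *\<^sub>R u s"
    by (intro vderiv_eq has_vector_derivative_scaleR)
  moreover have v: "vderiv (std_curve \<alpha> c) s = g s *\<^sub>R u s" if "s \<in> std_domain \<alpha>" for s
    unfolding g_def u_def by (rule vderiv_std_curve[OF False that])
  ultimately have a: "vderiv (vderiv (std_curve \<alpha> c)) s = g s *\<^sub>R w + vderiv g s *\<^sub>R u s"
    using vderiv_cong_open[OF open_std_domain s v] by simp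
  have sq: "cosh (\<alpha> * s) * cosh (\<alpha> * s) = sinh (\<alpha> * s) * sinh (\<alpha> * s) + 1"
    using cosh_square_eq[of "\<alpha> * s"] by (simp add: power2_eq_square)
  have "area (u s) w = \<alpha>"
    using sq by (simp add: area_def u_def w_def algebra_simps) 
  moreover have "lor (u s) (u s) = -1"
    using sq by (simp add: lor_def u_def)
  moreover have "area (u s) (sinh s, cosh s) = sinh ((\<alpha> + 1) * s)"
    by (simp add: area_def u_def distrib_right sinh_add)
  moreover have "std_radius \<alpha> c s = g s * sinh ((\<alpha> + 1) * s)"
    using sh[OF s] by (simp add: g_def)
  moreover have "lor (sinh s, cosh s) (sinh s, cosh s) = -1"
    using cosh_square_eq[of s] by (simp add: lor_def power2_eq_square)
  ultimately have "stationary_equation \<alpha> (std_radius \<alpha> c s *\<^sub>R (sinh s, cosh s))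
      (g s *\<^sub>R u s) (g s *\<^sub>R w + vderiv g s *\<^sub>R u s)"
    unfolding stationary_equation_factors by (simp add: power2_eq_square power3_eq_cube)
  then show ?thesis by (simp only: a v[OF s] std_curve_def)
qed

text \<open>
  Regularity, causal type and the stationarity identity pass from the standard curve to its image. Such an
  image is not radial because \<open>\<phi>\<close> takes two distinct values \<open>s\<close>, \<open>s'\<close>, and the vectors
  \<open>(sinh s, cosh s)\<close>, \<open>(sinh s', cosh s')\<close> violate the equality case of the reversed Cauchy-Schwarz inequality, as
  \<open>cosh (s - s') \<noteq> 1\<close>.
\<close>
lemma std_curve_image_stationary:
  assumes T: "linear_isometry T" and \<mu>: "\<mu> > 0" and c: "\<alpha> = -1 \<longrightarrow> c\<^sup>2 > 1"
    and K: "K \<subseteq> std_domain \<alpha>" and \<phi>: "reparametrization \<phi> I K"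
    and \<gamma>: "\<And>t. t \<in> I \<Longrightarrow> \<gamma> t = \<mu> *\<^sub>R T (std_curve \<alpha> c (\<phi> t))"
  shows "stationary \<alpha> \<gamma> I" "timelike \<gamma> I" "\<gamma> ` I \<subseteq> neg_region" "\<not> radial \<gamma> I"
proof -
  have I: "open_interval I" "open I" "open K" "smooth \<phi> I" "\<phi> ` I \<subseteq> K" "inj_on \<phi> I"
    and nz: "\<And>t. t \<in> I \<Longrightarrow> vderiv \<phi> t \<noteq> 0"
    using \<phi> by (auto simp: reparametrization_def open_interval_def bij_betw_def)
  have lT: "lor (T p) (T q) = lor p q" for p q using T unfolding linear_isometry_def by blast
  define L where "L = (\<lambda>p. \<mu> *\<^sub>R T p)"
  have lL: "lor (L p) (L q) = \<mu>\<^sup>2 * lor p q" for p q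
    by (simp only: L_def lor_scaleR lT)
  have L: "bounded_linear L"
    unfolding L_def
    using T by (intro bounded_linear_const_scaleR) (simp add: linear_isometry_def linear_conv_bounded_linear)
  have vL: "vderiv (\<lambda>s. L (f s)) s = L (vderiv f s)" if "smooth f K" "s \<in> K" for f s
    by (rule vderiv_eq[OF bounded_linear.has_vector_derivative[OF L smooth_deriv[OF that]]])
  have std: "smooth (std_curve \<alpha> c) K" using smooth_std_curve K by (rule smooth_subset)
  have \<delta>: "smooth (\<lambda>s. L (std_curve \<alpha> c s)) K"
    by (rule smooth_bounded_linear[OF I(3) L std])
  have \<delta>'': "vderiv (vderiv (\<lambda>s. L (std_curve \<alpha> c s))) s = L (vderiv (vderiv (std_curve \<alpha> c)) s)"
    if "s \<in> K" for s
    using vderiv_cong_open[OF I(3) that vL[OF std]] vL[OF smooth_vderiv[OF std] that] by simp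
  have eq: "\<gamma> t = L (std_curve \<alpha> c (\<phi> t))" if "t \<in> I" for t
    using \<gamma>[OF that] by (simp add: L_def)
  note d = vderiv_compose[OF I(2,3) \<delta> I(4,5)]
  have \<gamma>': "vderiv \<gamma> t = vderiv \<phi> t *\<^sub>R L (vderiv (std_curve \<alpha> c) (\<phi> t))" if "t \<in> I" for t
    using vderiv_cong_open[OF I(2) that eq] d(1)[OF that] vL[OF std, of "\<phi> t"] I(5) that by auto
  have \<gamma>'': "vderiv (vderiv \<gamma>) t = (vderiv \<phi> t)\<^sup>2 *\<^sub>R L (vderiv (vderiv (std_curve \<alpha> c)) (\<phi> t)) +
      vderiv (vderiv \<phi>) t *\<^sub>R L (vderiv (std_curve \<alpha> c) (\<phi> t))" if "t \<in> I" for t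
  proof -
    have "vderiv (vderiv \<gamma>) t = vderiv (vderiv (\<lambda>t. L (std_curve \<alpha> c (\<phi> t)))) t"
      by (rule vderiv_cong_open[OF I(2) that vderiv_cong_open[OF I(2) _ eq]])
    moreover have "\<phi> t \<in> K" using I(5) that by blast
    ultimately show ?thesis using d(2)[OF that] vL[OF std] \<delta>'' by simp
  qed
  have dom: "\<phi> t \<in> std_domain \<alpha>" if "t \<in> I" for t using I(5) K that by blast
  show tl: "timelike \<gamma> I"
    using \<mu> nz std_curve_timelike[OF c dom]
    by (auto simp: timelike_def \<gamma>' lor_scaleR lL mult_pos_neg)
  show neg: "\<gamma> ` I \<subseteq> neg_region"
    using \<mu> std_radius_pos[OF dom, of _ c]
    by (force simp: neg_region_def eq lL lor_std_curve)
  have reg: "regular_curve \<gamma> I"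
    unfolding regular_curve_def
  proof (intro conjI ballI I)
    have "smooth (\<lambda>t. L (std_curve \<alpha> c (\<phi> t))) I"
      by (rule smooth_compose[OF I(2) \<delta> I(4,5)])
    then show "smooth \<gamma> I" by (rule smooth_cong[OF I(2)]) (simp add: eq)
    show "vderiv \<gamma> t \<noteq> 0" if "t \<in> I" for t
      using tl that by (force simp: timelike_def lor_def)
  qed
  show "stationary \<alpha> \<gamma> I"
    unfolding stationary_iff_equation[OF reg tl neg]
  proof
    fix t assume t: "t \<in> I"
    show "stationary_equation \<alpha> (\<gamma> t) (vderiv \<gamma> t) (vderiv (vderiv \<gamma>) t)"
      unfolding \<gamma>'[OF t] \<gamma>''[OF t] stationary_equation_reparametrization[OF nz[OF t]] eq[OF t] L_def
      by (intro stationary_equation_similarity T std_curve_stationary_equation dom t)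
  qed
  show "\<not> radial \<gamma> I"
  proof
    assume "radial \<gamma> I"
    then obtain v where v: "\<gamma> ` I \<subseteq> straight_line 0 v" by (auto simp: radial_def)
    obtain t where t: "t \<in> I" using I(1) by (auto simp: open_interval_def)
    then obtain e where e: "e > 0" "ball t e \<subseteq> I" using I(2) open_contains_ball by blast
    then have t': "t + e / 2 \<in> I" by (auto simp: dist_real_def subset_iff)
    define s s' where ss: "s = \<phi> t" "s' = \<phi> (t + e / 2)"
    have "s \<noteq> s'" using I(6) t t' e(1) unfolding ss inj_on_def by force
    obtain r r' where "\<gamma> t = r *\<^sub>R v" "\<gamma> (t + e / 2) = r' *\<^sub>R v"
      using v t t' by (force simp: straight_line_def)
    then have "(lor (\<gamma> t) (\<gamma> (t + e / 2)))\<^sup>2 =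
        lor (\<gamma> t) (\<gamma> t) * lor (\<gamma> (t + e / 2)) (\<gamma> (t + e / 2))"
      by (simp add: lor_def power2_eq_square algebra_simps)
    then have "\<mu> ^ 4 * (lor (std_curve \<alpha> c s) (std_curve \<alpha> c s'))\<^sup>2 =
        \<mu> ^ 4 * (lor (std_curve \<alpha> c s) (std_curve \<alpha> c s) * lor (std_curve \<alpha> c s') (std_curve \<alpha> c s'))"
      by (simp add: eq[OF t] eq[OF t'] lL ss power2_eq_square power4_eq_xxxx mult_ac)
    then have "(lor (std_curve \<alpha> c s) (std_curve \<alpha> c s'))\<^sup>2 =
        (std_radius \<alpha> c s * std_radius \<alpha> c s')\<^sup>2"
      using \<mu> by (simp add: lor_std_curve power_mult_distrib)
    moreover have "lor (std_curve \<alpha> c s) (std_curve \<alpha> c s') =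
        - (std_radius \<alpha> c s * std_radius \<alpha> c s') * cosh (s - s')"
      by (simp add: lor_def std_curve_def cosh_diff algebra_simps)
    ultimately have "(std_radius \<alpha> c s * std_radius \<alpha> c s')\<^sup>2 * (cosh (s - s'))\<^sup>2 =
        (std_radius \<alpha> c s * std_radius \<alpha> c s')\<^sup>2 * 1"
      by (simp only: power_mult_distrib power2_minus mult_1_right)
    moreover have "std_radius \<alpha> c s * std_radius \<alpha> c s' \<noteq> 0"
      using std_radius_pos[OF dom[OF t], of c] std_radius_pos[OF dom[OF t'], of c] by (simp add: ss)
    ultimately have "(cosh (s - s'))\<^sup>2 = 1" by (simp only: mult_cancel_left) simp
    then have "sinh (s - s') = 0" by (simp add: cosh_square_eq)
    with \<open>s \<noteq> s'\<close> show False by simp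
  qed
qed

section \<open>Boosts and signs\<close>

lemma nonvanishing_constant_sign:
  fixes f :: "real \<Rightarrow> real"
  assumes "is_interval I" "continuous_on I f" "\<And>t. t \<in> I \<Longrightarrow> f t \<noteq> 0"
  obtains \<epsilon> where "\<bar>\<epsilon>\<bar> = 1" "\<And>t. t \<in> I \<Longrightarrow> \<bar>f t\<bar> = \<epsilon> * f t"
proof (cases "\<exists>t\<in>I. f t < 0")
  case True
  then obtain t0 where t0: "t0 \<in> I" "f t0 < 0" by blast
  have im: "is_interval (f ` I)"
    using connected_continuous_image[OF assms(2)] assms(1) by (simp add: is_interval_connected_1)
  have "f t < 0" if "t \<in> I" for t
  proof (rule ccontr)
    assume "\<not> f t < 0"
    then have "0 \<in> f ` I" using mem_is_interval_1_I[OF im, of "f t0" "f t" 0] t0 that by auto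
    with assms(3) show False by force
  qed
  then show thesis by (intro that[of "-1"]) (simp_all add: abs_of_neg)
next
  case False
  then show thesis by (intro that[of 1]) (auto simp: not_less)
qed

text \<open>
  The isometries needed for the normalization: \<open>\<eta>\<close> reflects the first coordinate, the boost adds \<open>d\<close> to the hyperbolic
  angle, and \<open>\<sigma>\<close> is \<open>\<plusminus>\<close> the identity, which chooses the component of \<open>\<C>\<^sup>-\<close>.
\<close>
definition boost :: "real \<Rightarrow> real \<Rightarrow> real \<Rightarrow> real \<times> real \<Rightarrow> real \<times> real"
  where "boost \<sigma> \<eta> d p = (\<sigma> * (\<eta> * fst p * cosh d + snd p * sinh d),
    \<sigma> * (\<eta> * fst p * sinh d + snd p * cosh d))"

lemma linear_isometry_boost:
  assumes "\<bar>\<sigma>\<bar> = 1" "\<bar>\<eta>\<bar> = 1"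
  shows "linear_isometry (boost \<sigma> \<eta> d)"
proof -
  have "\<sigma> * \<sigma> = 1" "\<eta> * \<eta> = 1" using assms by (auto simp: abs_if split: if_splits)
  moreover have "cosh d * cosh d = sinh d * sinh d + 1"
    using cosh_square_eq[of d] by (simp add: power2_eq_square)
  ultimately have "lor (boost \<sigma> \<eta> d p) (boost \<sigma> \<eta> d q) = lor p q" for p q
    unfolding lor_def boost_def fst_conv snd_conv by algebra
  moreover have "linear (boost \<sigma> \<eta> d)"
    by (rule linearI) (simp_all add: boost_def algebra_simps)
  ultimately show ?thesis by (simp add: linear_isometry_def)
qed

lemma boost_polar:
  assumes "\<bar>\<eta>\<bar> = 1"
  shows "boost \<sigma> \<eta> d (r *\<^sub>R (sinh s, cosh s)) = (\<sigma> * r) *\<^sub>R (sinh (d + \<eta> * s), cosh (d + \<eta> * s))"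
proof -
  have "\<eta> = 1 \<or> \<eta> = -1" using assms by linarith
  then show ?thesis by (auto simp: boost_def sinh_add cosh_add sinh_diff cosh_diff algebra_simps)
qed

section \<open>Integrating the stationarity identity\<close>

text \<open>
  In polar coordinates \<open>\<rho>\<close>, \<open>\<theta>\<close> the quantities below are \<open>A = \<rho>\<^sup>2 \<theta>'\<close>, \<open>P = \<rho> \<rho>'\<close>, \<open>R = \<rho>\<^sup>2\<close> and \<open>S = \<bar>\<langle>\<gamma>', \<gamma>'\<rangle>\<bar>\<close>.
  With \<open>w\<close> the hyperbolic angle between position and velocity, \<open>A = \<surd>(R S) sinh w\<close> and \<open>\<bar>P\<bar> = \<surd>(R S) cosh w\<close>, so
  \<open>A / \<surd>(R S)\<close> stands for \<open>sinh w\<close> and no second angle function has to be defined.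
\<close>
locale stationary_timelike_curve =
  fixes \<alpha> :: real and \<gamma> :: "real \<Rightarrow> real \<times> real" and I :: "real set"
  assumes interval: "open_interval I" and smooth_curve: "smooth \<gamma> I"
    and timelike_curve: "timelike \<gamma> I" and in_neg_region: "\<gamma> ` I \<subseteq> neg_region"
    and equation: "\<And>t. t \<in> I \<Longrightarrow> stationary_equation \<alpha> (\<gamma> t) (vderiv \<gamma> t) (vderiv (vderiv \<gamma>) t)"
begin

abbreviation "A t \<equiv> area (vderiv \<gamma> t) (\<gamma> t)"
abbreviation "P t \<equiv> - lor (vderiv \<gamma> t) (\<gamma> t)"
abbreviation "R t \<equiv> - lor (\<gamma> t) (\<gamma> t)"
abbreviation "S t \<equiv> - lor (vderiv \<gamma> t) (vderiv \<gamma> t)"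

text \<open>
  The hyperbolic angle \<open>\<theta> = artanh (x / y)\<close>, in a form whose smoothness only involves the logarithm.
\<close>
definition angle :: "real \<Rightarrow> real"
  where "angle t = ln ((snd (\<gamma> t) + fst (\<gamma> t)) / (snd (\<gamma> t) - fst (\<gamma> t))) / 2"

lemma open_I: "open I" and convex_I: "convex I" and is_interval_I: "is_interval I"
  using interval by (simp_all add: open_interval_def is_interval_convex_1)

lemma R_pos: "t \<in> I \<Longrightarrow> R t > 0" and S_pos: "t \<in> I \<Longrightarrow> S t > 0"
  using in_neg_region timelike_curve by (auto simp: neg_region_def timelike_def)

lemma R_factors: "R t = (snd (\<gamma> t) - fst (\<gamma> t)) * (snd (\<gamma> t) + fst (\<gamma> t))"
  by (simp add: lor_def algebra_simps)

lemma P_square: "(P t)\<^sup>2 = (A t)\<^sup>2 + R t * S t"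
  by (simp add: area_def lor_def power2_eq_square algebra_simps)

lemma component_derivatives:
  assumes "t \<in> I"
  shows "((\<lambda>t. fst (\<gamma> t)) has_real_derivative fst (vderiv \<gamma> t)) (at t)"
    "((\<lambda>t. snd (\<gamma> t)) has_real_derivative snd (vderiv \<gamma> t)) (at t)"
    "((\<lambda>t. fst (vderiv \<gamma> t)) has_real_derivative fst (vderiv (vderiv \<gamma>) t)) (at t)"
    "((\<lambda>t. snd (vderiv \<gamma> t)) has_real_derivative snd (vderiv (vderiv \<gamma>) t)) (at t)"
proof -
  note fst = bounded_linear.has_vector_derivative[OF bounded_linear_fst]
    and snd = bounded_linear.has_vector_derivative[OF bounded_linear_snd]
    and d1 = smooth_deriv[OF smooth_curve assms]
    and d2 = smooth_deriv[OF smooth_vderiv[OF smooth_curve] assms]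
  show "((\<lambda>t. fst (\<gamma> t)) has_real_derivative fst (vderiv \<gamma> t)) (at t)"
    "((\<lambda>t. snd (\<gamma> t)) has_real_derivative snd (vderiv \<gamma> t)) (at t)"
    "((\<lambda>t. fst (vderiv \<gamma> t)) has_real_derivative fst (vderiv (vderiv \<gamma>) t)) (at t)"
    "((\<lambda>t. snd (vderiv \<gamma> t)) has_real_derivative snd (vderiv (vderiv \<gamma>) t)) (at t)"
    using fst[OF d1] snd[OF d1] fst[OF d2] snd[OF d2]
    by (simp_all add: has_real_derivative_iff_has_vector_derivative)
qed

lemma R_deriv: "t \<in> I \<Longrightarrow> (R has_real_derivative 2 * P t) (at t)"
  unfolding lor_def by (auto intro!: derivative_eq_intros component_derivatives simp: algebra_simps)

lemma angle_arg_pos: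
  assumes "t \<in> I" shows "(snd (\<gamma> t) + fst (\<gamma> t)) / (snd (\<gamma> t) - fst (\<gamma> t)) > 0"
  using R_pos[OF assms] unfolding R_factors by (auto simp: zero_less_mult_iff zero_less_divide_iff)

lemma smooth_angle: "smooth angle I"
  unfolding angle_def[abs_def]
proof (intro smooth_divide smooth_ln smooth_add smooth_diff smooth_fst_snd smooth_const open_I smooth_curve angle_arg_pos)
  show "snd (\<gamma> t) - fst (\<gamma> t) \<noteq> 0" if "t \<in> I" for t
    using R_pos[OF that] unfolding R_factors by auto
qed auto

lemma angle_deriv:
  assumes t: "t \<in> I" shows "(angle has_real_derivative A t / R t) (at t)"
proof -
  define x y x' y' where xy: "x = fst (\<gamma> t)" "y = snd (\<gamma> t)"
    "x' = fst (vderiv \<gamma> t)" "y' = snd (vderiv \<gamma> t)"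
  have nz: "y - x \<noteq> 0" "y + x \<noteq> 0"
    using R_pos[OF t] unfolding R_factors xy by auto
  have "((\<lambda>t. (snd (\<gamma> t) + fst (\<gamma> t)) / (snd (\<gamma> t) - fst (\<gamma> t))) has_real_derivative
      ((y' + x') * (y - x) - (y + x) * (y' - x')) / ((y - x) * (y - x))) (at t)"
    unfolding xy
    by (intro DERIV_divide DERIV_add DERIV_diff component_derivatives[OF t]) (use nz xy in simp)
  from DERIV_cdivide[OF DERIV_chain2[OF DERIV_ln_divide[OF angle_arg_pos[OF t]] this], of 2]
  have "(angle has_real_derivative
      1 / ((y + x) / (y - x)) * (((y' + x') * (y - x) - (y + x) * (y' - x')) / ((y - x) * (y - x))) / 2) (at t)"
    unfolding angle_def[abs_def] xy .
  moreover have "1 / ((y + x) / (y - x)) * (((y' + x') * (y - x) - (y + x) * (y' - x')) / ((y - x) * (y - x))) / 2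
      = (x' * y - y' * x) / ((y - x) * (y + x))"
    using nz by (simp add: divide_simps) (simp add: algebra_simps)
  ultimately show ?thesis by (simp only: R_factors area_def xy)
qed

lemma polar_form:
  assumes t: "t \<in> I"
  shows "\<gamma> t = (sgn (snd (\<gamma> t)) * sqrt (R t)) *\<^sub>R (sinh (angle t), cosh (angle t))"
proof -
  define x y where xy: "x = fst (\<gamma> t)" "y = snd (\<gamma> t)"
  define E where "E = exp (angle t)"
  have R: "R t = (y - x) * (y + x)" unfolding R_factors xy ..
  have pos: "(y - x) * (y + x) > 0" using R_pos[OF t] unfolding R .
  then have ne: "y - x \<noteq> 0" "y + x \<noteq> 0" by auto
  have E: "E > 0" by (simp add: E_def)
  have eq_abs: "a = \<bar>b\<bar>" if "a\<^sup>2 = b\<^sup>2" "a > 0" for a b :: real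
    using that by (auto simp: power2_eq_iff)
  have "E\<^sup>2 = exp (2 * angle t)" by (simp add: E_def exp_double)
  also have "\<dots> = (y + x) / (y - x)"
    using angle_arg_pos[OF t] by (simp add: angle_def xy)
  finally have E2: "E\<^sup>2 = (y + x) / (y - x)" .
  have "(sqrt (R t) * E)\<^sup>2 = (y + x)\<^sup>2"
    using pos ne unfolding R power_mult_distrib E2
    by (simp only: real_sqrt_pow2 less_imp_le) (simp add: power2_eq_square)
  then have 1: "sqrt (R t) * E = \<bar>y + x\<bar>"
    using E R_pos[OF t] by (intro eq_abs) simp_all
  have "(sqrt (R t) / E)\<^sup>2 = (y - x)\<^sup>2"
    using pos ne unfolding R power_divide E2
    by (simp only: real_sqrt_pow2 less_imp_le) (simp add: power2_eq_square)
  then have 2: "sqrt (R t) / E = \<bar>y - x\<bar>"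
    using E R_pos[OF t] by (intro eq_abs) simp_all
  have "q * sinh (angle t) = (q * E - q / E) / 2" "q * cosh (angle t) = (q * E + q / E) / 2" for q
    unfolding sinh_field_def cosh_field_def exp_minus E_def[symmetric]
    using E by (simp_all add: field_simps)
  then have "sqrt (R t) * sinh (angle t) = (\<bar>y + x\<bar> - \<bar>y - x\<bar>) / 2"
    "sqrt (R t) * cosh (angle t) = (\<bar>y + x\<bar> + \<bar>y - x\<bar>) / 2"
    by (simp_all only: 1 2)
  moreover have "(y - x > 0 \<and> y + x > 0) \<or> (y - x < 0 \<and> y + x < 0)"
    using pos by (simp add: zero_less_mult_iff)
  ultimately have "sgn y * (sqrt (R t) * sinh (angle t)) = x" "sgn y * (sqrt (R t) * cosh (angle t)) = y"
    by (auto simp: sgn_if mult.commute)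
  then show ?thesis unfolding xy by (simp add: prod_eq_iff mult.assoc)
qed

text \<open>
  This is \<open>\<rho>\<^bsup>\<alpha> + 1\<^esup> sinh w = Q\<close>. The equivalent quantity \<open>G = A R\<^bsup>\<alpha> / 2\<^esup> S\<^bsup>- 1 / 2\<^esup>\<close> has derivative zero: the
  stationarity identity replaces \<open>\<alpha> A S / R\<close> by \<open>area v a\<close>, and what remains is the linear relation between the three vectors
  \<open>\<gamma>\<close>, \<open>\<gamma>'\<close>, \<open>\<gamma>''\<close> in the plane, paired with \<open>\<gamma>'\<close>.
\<close>
lemma momentum_conserved:
  obtains Q where "\<And>t. t \<in> I \<Longrightarrow> A t / sqrt (R t * S t) = Q * exp (- (\<alpha> + 1) / 2 * ln (R t))"
proof -
  \<comment> \<open>The powers of \<open>R\<close> and \<open>S\<close> in \<open>G\<close> are collected in one exponent, to be differentiated as a sum.\<close>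
  define u where "u = (\<lambda>t. \<alpha> / 2 * ln (R t) - ln (S t) / 2)"
  define G where "G = (\<lambda>t. A t * exp (u t))"
  have "(G has_real_derivative 0) (at t)" if t: "t \<in> I" for t
  proof -
    define a where "a = vderiv (vderiv \<gamma>) t"
    define v where "v = vderiv \<gamma> t"
    have S': "(S has_real_derivative - 2 * lor v a) (at t)"
      unfolding lor_def a_def v_def
      by (auto intro!: derivative_eq_intros component_derivatives[OF t] simp: algebra_simps)
    have A': "(A has_real_derivative area a (\<gamma> t)) (at t)"
      unfolding area_def a_def
      by (auto intro!: derivative_eq_intros component_derivatives[OF t] simp: algebra_simps)
    have u': "(u has_real_derivative \<alpha> * P t / R t + lor v a / S t) (at t)"
      unfolding u_def
      by (rule derivative_eq_intros refl R_deriv[OF t] S' R_pos[OF t] S_pos[OF t] | simp)+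
    have "(G has_real_derivative
        exp (u t) * (area a (\<gamma> t) + A t * (\<alpha> * P t / R t + lor v a / S t))) (at t)"
      unfolding G_def by (rule derivative_eq_intros refl A' u' | simp add: algebra_simps)+
    moreover have "area a (\<gamma> t) + A t * (\<alpha> * P t / R t + lor v a / S t) = 0"
    proof -
      have "area v a * R t = \<alpha> * A t * S t"
        using equation[OF t] by (simp add: stationary_equation_def a_def v_def)
      then have e: "\<alpha> * A t * S t / R t = area v a"
        using R_pos[OF t] by (simp add: field_simps)
      have distr: "s * (x + b * (\<alpha> * p / r + l / s)) = s * x + (\<alpha> * b * s / r) * p + b * l"
        if "s > 0" for s x b p r l :: real
        using that by (simp add: algebra_simps)
      have "S t * (area a (\<gamma> t) + A t * (\<alpha> * P t / R t + lor v a / S t)) =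
          S t * area a (\<gamma> t) + area v a * P t + A t * lor v a"
        unfolding distr[OF S_pos[OF t]] e ..
      also have "\<dots> = 0"
        by (simp add: lor_def area_def v_def algebra_simps)
      finally show ?thesis using S_pos[OF t] by simp
    qed
    ultimately show ?thesis by simp
  qed
  then obtain Q where Q: "\<And>t. t \<in> I \<Longrightarrow> G t = Q"
    using has_field_derivative_zero_constant[OF convex_I, of G] has_field_derivative_at_within by blast
  show thesis
  proof (rule that[of Q])
    fix t assume t: "t \<in> I"
    have sq: "sqrt (R t * S t) = exp (ln (R t) / 2 + ln (S t) / 2)"
    proof -
      have "exp (ln (R t) / 2 + ln (S t) / 2) = sqrt (R t) * sqrt (S t)"
        using R_pos[OF t] S_pos[OF t] by (simp add: exp_add ln_sqrt[symmetric])
      then show ?thesis by (simp only: real_sqrt_mult)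
    qed
    have "A t = Q * exp (- u t)"
      using Q[OF t] by (auto simp: G_def exp_minus)
    then have "A t / sqrt (R t * S t) = Q * exp (- u t - (ln (R t) / 2 + ln (S t) / 2))"
      unfolding sq by (simp add: exp_diff)
    also have "- u t - (ln (R t) / 2 + ln (S t) / 2) = - (\<alpha> + 1) / 2 * ln (R t)"
      by (simp add: u_def field_simps)
    finally show "A t / sqrt (R t * S t) = Q * exp (- (\<alpha> + 1) / 2 * ln (R t))" .
  qed
qed

lemma sqrt_RS_pos: "t \<in> I \<Longrightarrow> sqrt (R t * S t) > 0"
  using R_pos S_pos by (simp only: real_sqrt_gt_zero mult_pos_pos)

lemma constant_if_derivative_zero:
  assumes "\<And>t. t \<in> I \<Longrightarrow> (f has_real_derivative 0) (at t)"
  shows "\<exists>C. \<forall>t\<in>I. f t = C"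
  by (rule has_field_derivative_zero_constant[OF convex_I has_field_derivative_at_within[OF assms]])

text \<open>
  A timelike curve in \<open>\<C>\<^sup>-\<close> moves monotonically away from or towards the origin: \<open>P = \<rho> \<rho>'\<close> cannot vanish, because
  \<open>P\<^sup>2 \<ge> R S\<close>.
\<close>
lemma P_sign:
  obtains \<epsilon> where "\<bar>\<epsilon>\<bar> = 1" "\<And>t. t \<in> I \<Longrightarrow> \<bar>P t\<bar> = \<epsilon> * P t"
proof (rule nonvanishing_constant_sign[OF is_interval_I, of P])
  have "smooth P I"
    unfolding lor_def
    by (intro smooth_minus smooth_diff smooth_mult smooth_fst_snd smooth_vderiv smooth_curve open_I)
  then show "continuous_on I P" by (rule smooth_continuous_on)
  show "P t \<noteq> 0" if "t \<in> I" for t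
  proof
    assume "P t = 0"
    then have "(A t)\<^sup>2 + R t * S t = 0" using P_square[of t] by simp
    moreover have "R t * S t > 0" using that R_pos S_pos by (simp only: mult_pos_pos)
    ultimately show False using zero_le_power2[of "A t"] by linarith
  qed
qed (rule that)

text \<open>
  This is \<open>cosh w\<close> computed from \<open>sinh w\<close>.
\<close>
lemma hypotenuse:
  assumes "t \<in> I" shows "sqrt ((A t / sqrt (R t * S t))\<^sup>2 + 1) = \<bar>P t\<bar> / sqrt (R t * S t)"
proof (rule real_sqrt_unique)
  have RS: "R t * S t > 0" using assms R_pos S_pos by (simp only: mult_pos_pos)
  then have "(\<bar>P t\<bar> / sqrt (R t * S t))\<^sup>2 = (P t)\<^sup>2 / (R t * S t)"
    by (simp only: power_divide power2_abs real_sqrt_pow2 less_imp_le)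
  also have "\<dots> = ((A t)\<^sup>2 + R t * S t) / (R t * S t)" by (simp only: P_square)
  also have "\<dots> = (A t)\<^sup>2 / (R t * S t) + 1"
    by (simp only: add_divide_distrib divide_self[OF less_imp_neq[OF RS, symmetric]])
  also have "\<dots> = (A t / sqrt (R t * S t))\<^sup>2 + 1"
    using RS by (simp only: power_divide power2_abs real_sqrt_pow2 less_imp_le)
  finally show "(\<bar>P t\<bar> / sqrt (R t * S t))\<^sup>2 = (A t / sqrt (R t * S t))\<^sup>2 + 1" .
qed (use sqrt_RS_pos[OF assms] in simp)

lemma ln_R_deriv:
  assumes "t \<in> I" shows "((\<lambda>t. ln (R t) / 2) has_real_derivative P t / R t) (at t)"
  using DERIV_cdivide[OF DERIV_chain2[OF DERIV_ln_divide[OF R_pos[OF assms]] R_deriv[OF assms]], of 2]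
  by simp

text \<open>
  Solving the conservation law for \<open>w = arsinh (Q \<rho>\<^bsup>- (\<alpha> + 1)\<^esup>)\<close> and differentiating gives
  \<open>\<epsilon> w' = - (\<alpha> + 1) \<theta>'\<close>, where the sign \<open>\<epsilon>\<close> of \<open>\<rho>'\<close> comes from \<open>cosh w = \<epsilon> P / \<surd>(R S)\<close>.
\<close>
lemma tilt_angle_affine:
  assumes Q: "\<And>t. t \<in> I \<Longrightarrow> A t / sqrt (R t * S t) = Q * exp (- (\<alpha> + 1) / 2 * ln (R t))"
  obtains \<epsilon> C where "\<bar>\<epsilon>\<bar> = 1"
    "\<And>t. t \<in> I \<Longrightarrow> \<epsilon> * (Q * exp (- (\<alpha> + 1) / 2 * ln (R t))) = sinh (C - (\<alpha> + 1) * angle t)"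
proof -
  obtain \<epsilon> where \<epsilon>: "\<bar>\<epsilon>\<bar> = 1" "\<And>t. t \<in> I \<Longrightarrow> \<bar>P t\<bar> = \<epsilon> * P t" using P_sign by blast
  define q where "q = (\<lambda>t. Q * exp (- (\<alpha> + 1) * (ln (R t) / 2)))"
  have q: "q t = A t / sqrt (R t * S t)" "q t = Q * exp (- (\<alpha> + 1) / 2 * ln (R t))" if "t \<in> I" for t
    using Q[OF that] by (simp_all add: q_def)
  define H where "H = (\<lambda>t. \<epsilon> * arsinh (q t) + (\<alpha> + 1) * angle t)"
  have "(H has_real_derivative 0) (at t)" if t: "t \<in> I" for t
  proof -
    define r where "r = sqrt (R t * S t)"
    have r: "r > 0" unfolding r_def by (rule sqrt_RS_pos[OF t])
    have ne: "R t \<noteq> 0" "\<epsilon> * P t \<noteq> 0"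
    proof -
      have "(P t)\<^sup>2 > 0"
        unfolding P_square using R_pos[OF t] S_pos[OF t] by (simp only: add_nonneg_pos mult_pos_pos zero_le_power2)
      then show "\<epsilon> * P t \<noteq> 0" using \<epsilon>(1) by auto
      show "R t \<noteq> 0" using R_pos[OF t] by simp
    qed
    have "(q has_real_derivative - (\<alpha> + 1) * (P t / R t) * q t) (at t)"
      using DERIV_cmult[OF DERIV_chain2[OF DERIV_exp
            DERIV_cmult[OF ln_R_deriv[OF t], of "- (\<alpha> + 1)"]], of Q]
      unfolding q_def by (simp only: mult_ac)
    from DERIV_add[OF DERIV_cmult[OF DERIV_chain2[OF arsinh_real_has_field_derivative this], of \<epsilon>]
        DERIV_cmult[OF angle_deriv[OF t], of "\<alpha> + 1"]]
    have "(H has_real_derivative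
        \<epsilon> * (1 / sqrt ((q t)\<^sup>2 + 1) * (- (\<alpha> + 1) * (P t / R t) * q t)) + (\<alpha> + 1) * (A t / R t)) (at t)"
      unfolding H_def .
    moreover have "\<epsilon> * (1 / sqrt ((q t)\<^sup>2 + 1) * (- (\<alpha> + 1) * (P t / R t) * q t)) = - (\<alpha> + 1) * (A t / R t)"
    proof -
      have "\<epsilon> * (1 / (\<epsilon> * p / r) * (- (\<alpha> + 1) * (p / R') * (a / r))) = - (\<alpha> + 1) * (a / R')"
        if "R' \<noteq> 0" "\<epsilon> * p \<noteq> 0" for R' p a
        using r that by (simp add: field_simps)
      from this[OF ne] show ?thesis
        unfolding q(1)[OF t] hypotenuse[OF t] \<epsilon>(2)[OF t] r_def .
    qed
    ultimately have "(H has_real_derivative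
        - (\<alpha> + 1) * (A t / R t) + (\<alpha> + 1) * (A t / R t)) (at t)" by (simp only:)
    then show ?thesis by (simp only: mult_minus_left ab_left_minus)
  qed
  then obtain C where C: "\<And>t. t \<in> I \<Longrightarrow> H t = C"
    using constant_if_derivative_zero[of H] by blast
  have "\<epsilon> = 1 \<or> \<epsilon> = -1" using \<epsilon>(1) by linarith
  then have odd: "\<epsilon> * sinh x = sinh (\<epsilon> * x)" for x by auto
  show thesis
  proof (rule that[OF \<epsilon>(1)])
    fix t assume t: "t \<in> I"
    have "\<epsilon> * q t = sinh (\<epsilon> * arsinh (q t))" by (simp flip: odd)
    also have "\<epsilon> * arsinh (q t) = C - (\<alpha> + 1) * angle t" using C[OF t] by (simp add: H_def)
    finally show "\<epsilon> * (Q * exp (- (\<alpha> + 1) / 2 * ln (R t))) = sinh (C - (\<alpha> + 1) * angle t)"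
      by (simp only: q(2)[OF t])
  qed
qed

lemma radial_if_area_zero:
  assumes "\<And>t. t \<in> I \<Longrightarrow> A t = 0" shows "radial \<gamma> I"
proof -
  have "(angle has_real_derivative 0) (at t)" if "t \<in> I" for t
    using angle_deriv[OF that] assms[OF that] by simp
  then obtain C where "\<And>t. t \<in> I \<Longrightarrow> angle t = C"
    using constant_if_derivative_zero[of angle] by blast
  then have "\<gamma> t = 0 + (sgn (snd (\<gamma> t)) * sqrt (R t)) *\<^sub>R (sinh C, cosh C)" if "t \<in> I" for t
    using polar_form[OF that] that by (simp only: add_0)
  then show ?thesis unfolding radial_def straight_line_def by blast
qed

lemma y_sign:
  obtains \<sigma> where "\<bar>\<sigma>\<bar> = 1" "\<And>t. t \<in> I \<Longrightarrow> sgn (snd (\<gamma> t)) = \<sigma>"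
proof -
  have nz: "snd (\<gamma> t) \<noteq> 0" if "t \<in> I" for t
  proof
    assume "snd (\<gamma> t) = 0"
    then show False using R_pos[OF that] zero_le_square[of "fst (\<gamma> t)"] by (simp add: lor_def)
  qed
  obtain \<sigma> where \<sigma>: "\<bar>\<sigma>\<bar> = 1" "\<And>t. t \<in> I \<Longrightarrow> \<bar>snd (\<gamma> t)\<bar> = \<sigma> * snd (\<gamma> t)"
    using nonvanishing_constant_sign[OF is_interval_I, of "\<lambda>t. snd (\<gamma> t)"]
      smooth_continuous_on[OF smooth_fst_snd(2)[OF open_I smooth_curve]] nz by blast
  then show thesis
  proof (intro that[of \<sigma>])
    fix t assume t: "t \<in> I"
    have "snd (\<gamma> t) * sgn (snd (\<gamma> t)) = snd (\<gamma> t) * \<sigma>"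
      using \<sigma>(2)[OF t] by (simp only: abs_sgn mult.commute)
    then show "sgn (snd (\<gamma> t)) = \<sigma>" using nz[OF t] by simp
  qed
qed

text \<open>
  A curve is recovered from its polar coordinates: once \<open>\<rho>\<close> is the standard radius as a function of the normalized angle
  \<open>\<eta> (\<theta> - d)\<close>, that angle is the parameter change. It is regular since \<open>\<theta>' = A / R\<close>.
\<close>
lemma std_curve_imageI:
  assumes nz: "\<And>t. t \<in> I \<Longrightarrow> A t \<noteq> 0" and \<eta>: "\<bar>\<eta>\<bar> = 1" and \<mu>: "\<mu> > 0" and c: "\<alpha> = -1 \<longrightarrow> c\<^sup>2 > 1"
    and dom: "\<And>t. t \<in> I \<Longrightarrow> \<eta> * (angle t - d) \<in> std_domain \<alpha>"
    and rad: "\<And>t. t \<in> I \<Longrightarrow> sqrt (R t) = \<mu> * std_radius \<alpha> c (\<eta> * (angle t - d))"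
  shows "\<exists>T \<mu> c K \<phi>. linear_isometry T \<and> \<mu> > 0 \<and> (\<alpha> = -1 \<longrightarrow> c\<^sup>2 > 1) \<and>
           K \<subseteq> std_domain \<alpha> \<and> reparametrization \<phi> I K \<and>
           (\<forall>t\<in>I. \<gamma> t = \<mu> *\<^sub>R T (std_curve \<alpha> c (\<phi> t)))"
proof -
  obtain \<sigma> where \<sigma>: "\<bar>\<sigma>\<bar> = 1" "\<And>t. t \<in> I \<Longrightarrow> sgn (snd (\<gamma> t)) = \<sigma>" using y_sign by blast
  define \<phi> where "\<phi> = (\<lambda>t. \<eta> * (angle t - d))"
  have "\<eta> = 1 \<or> \<eta> = -1" using \<eta> by linarith
  then have \<eta>\<eta>: "\<eta> * \<eta> = 1" by auto
  have d: "(\<phi> has_vector_derivative \<eta> * (A t / R t)) (at t)" if "t \<in> I" for t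
    unfolding has_real_derivative_iff_has_vector_derivative[symmetric] \<phi>_def
    by (rule derivative_eq_intros angle_deriv[OF that] refl)+ simp
  have "vderiv \<phi> t \<noteq> 0" if "t \<in> I" for t
    unfolding vderiv_eq[OF d[OF that]] using nz[OF that] R_pos[OF that] \<eta> by auto
  moreover have "smooth \<phi> I"
    unfolding \<phi>_def by (intro smooth_mult smooth_diff smooth_const smooth_angle open_I)
  ultimately have rep: "reparametrization \<phi> I (\<phi> ` I)"
    by (intro reparametrization_image interval)
  have "\<gamma> t = \<mu> *\<^sub>R boost \<sigma> \<eta> d (std_curve \<alpha> c (\<phi> t))" if t: "t \<in> I" for t
  proof -
    have "boost \<sigma> \<eta> d (std_curve \<alpha> c (\<phi> t)) =
        (\<sigma> * std_radius \<alpha> c (\<phi> t)) *\<^sub>R (sinh (d + \<eta> * \<phi> t), cosh (d + \<eta> * \<phi> t))"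
      unfolding std_curve_def by (rule boost_polar[OF \<eta>])
    also have "d + \<eta> * \<phi> t = angle t"
      by (simp add: \<phi>_def \<eta>\<eta> flip: mult.assoc)
    finally have "\<mu> *\<^sub>R boost \<sigma> \<eta> d (std_curve \<alpha> c (\<phi> t)) =
        (\<sigma> * (\<mu> * std_radius \<alpha> c (\<phi> t))) *\<^sub>R (sinh (angle t), cosh (angle t))"
      by (simp only: scaleR_scaleR mult_ac)
    also have "\<mu> * std_radius \<alpha> c (\<phi> t) = sqrt (R t)"
      unfolding \<phi>_def by (rule rad[OF t, symmetric])
    finally show ?thesis using polar_form[OF t] \<sigma>(2)[OF t] by simp
  qed
  moreover have "\<phi> ` I \<subseteq> std_domain \<alpha>" using dom by (auto simp: \<phi>_def)
  ultimately show ?thesis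
    using linear_isometry_boost[OF \<sigma>(1) \<eta>] \<mu> c rep by blast
qed

text \<open>
  For \<open>\<alpha> = -1\<close> both \<open>sinh w = Q\<close> and \<open>cosh w\<close> are constant, hence so is \<open>c = P / A = \<plusminus> \<surd>(Q\<^sup>2 + 1) / Q\<close>, and
  \<open>(ln \<rho>)' = P / R = c \<theta>'\<close>. For \<open>\<alpha> \<noteq> -1\<close> the sign \<open>\<eta>\<close> is chosen such that the normalized angle lies in the standard domain.
\<close>
theorem nonradial_is_std_curve_image:
  assumes nonradial: "\<not> radial \<gamma> I"
  shows "\<exists>T \<mu> c K \<phi>. linear_isometry T \<and> \<mu> > 0 \<and> (\<alpha> = -1 \<longrightarrow> c\<^sup>2 > 1) \<and>
           K \<subseteq> std_domain \<alpha> \<and> reparametrization \<phi> I K \<and>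
           (\<forall>t\<in>I. \<gamma> t = \<mu> *\<^sub>R T (std_curve \<alpha> c (\<phi> t)))"
proof -
  obtain Q where Q: "\<And>t. t \<in> I \<Longrightarrow> A t / sqrt (R t * S t) = Q * exp (- (\<alpha> + 1) / 2 * ln (R t))"
    using momentum_conserved by blast
  have A: "A t = Q * exp (- (\<alpha> + 1) / 2 * ln (R t)) * sqrt (R t * S t)" if "t \<in> I" for t
    by (rule iffD1[OF nonzero_divide_eq_eq[OF less_imp_neq[OF sqrt_RS_pos[OF that], symmetric]] Q[OF that]])
  have Q0: "Q \<noteq> 0"
  proof
    assume "Q = 0"
    then have "A t = 0" if "t \<in> I" for t using A[OF that] by simp
    with radial_if_area_zero nonradial show False by blast
  qed
  have A0: "A t \<noteq> 0" if "t \<in> I" for t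
    unfolding A[OF that] using Q0 less_imp_neq[OF sqrt_RS_pos[OF that], symmetric] by simp
  have sqrt_R: "sqrt (R t) = exp (ln (R t) / 2)" if "t \<in> I" for t
    using R_pos[OF that] by (simp add: ln_sqrt[symmetric])
  show ?thesis
  proof (cases "\<alpha> = -1")
    case True
    obtain \<epsilon> where \<epsilon>: "\<bar>\<epsilon>\<bar> = 1" "\<And>t. t \<in> I \<Longrightarrow> \<bar>P t\<bar> = \<epsilon> * P t" using P_sign by blast
    have \<epsilon>2: "\<epsilon>\<^sup>2 = 1" using \<epsilon>(1) by (simp add: power2_eq_1_iff abs_if split: if_splits) 
    define c where "c = \<epsilon> * sqrt (Q\<^sup>2 + 1) / Q"
    have "c\<^sup>2 = (Q\<^sup>2 + 1) / Q\<^sup>2" by (simp add: c_def power_divide power_mult_distrib \<epsilon>2)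
    also have "\<dots> = 1 + 1 / Q\<^sup>2" using Q0 by (simp add: add_divide_distrib)
    finally have c: "c\<^sup>2 > 1" using Q0 by simp
    have P: "P t = c * A t" if "t \<in> I" for t
    proof -
      have "sqrt (Q\<^sup>2 + 1) = \<epsilon> * P t / sqrt (R t * S t)"
        using hypotenuse[OF that] Q[OF that] \<epsilon>(2)[OF that] by (simp add: True)
      moreover have "A t = Q * sqrt (R t * S t)"
        using A[OF that] by (simp add: True)
      ultimately have "c * A t = \<epsilon> * (\<epsilon> * P t / sqrt (R t * S t) * sqrt (R t * S t))"
        using Q0 by (simp only: c_def) simp
      also have "\<dots> = \<epsilon> * (\<epsilon> * P t)"
        by (subst nonzero_eq_divide_eq[THEN iffD1, OF less_imp_neq[OF sqrt_RS_pos[OF that], symmetric] refl])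
          (rule refl)
      finally have "c * A t = \<epsilon>\<^sup>2 * P t" by (simp only: power2_eq_square mult.assoc)
      then show ?thesis by (simp add: \<epsilon>2)
    qed
    have "((\<lambda>t. ln (R t) / 2 - c * angle t) has_real_derivative 0) (at t)" if "t \<in> I" for t
      using DERIV_diff[OF ln_R_deriv[OF that] DERIV_cmult[OF angle_deriv[OF that], of c]]
      unfolding P[OF that] by simp
    then obtain C where C: "\<And>t. t \<in> I \<Longrightarrow> ln (R t) / 2 - c * angle t = C"
      using constant_if_derivative_zero[of "\<lambda>t. ln (R t) / 2 - c * angle t"] by blast
    show ?thesis
    proof (rule std_curve_imageI[OF A0, of 1 "exp C" c 0])
      show "sqrt (R t) = exp C * std_radius \<alpha> c (1 * (angle t - 0))" if "t \<in> I" for t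
      proof -
        have "ln (R t) / 2 = C + c * angle t" using C[OF that] by simp
        then show ?thesis unfolding sqrt_R[OF that] by (simp only: exp_add) (simp add: std_radius_def True)
      qed
    qed (use c True in \<open>auto simp: std_domain_def\<close>)
  next
    case False
    define a where "a = \<alpha> + 1"
    have a: "a \<noteq> 0" using False by (simp add: a_def)
    obtain \<epsilon> C where \<epsilon>: "\<bar>\<epsilon>\<bar> = 1"
      and C: "\<And>t. t \<in> I \<Longrightarrow> \<epsilon> * (Q * exp (- (\<alpha> + 1) / 2 * ln (R t))) = sinh (C - (\<alpha> + 1) * angle t)"
      using tilt_angle_affine[OF Q] by blast
    define \<eta> where "\<eta> = - sgn (\<epsilon> * Q)"
    have \<epsilon>Q: "\<epsilon> * Q \<noteq> 0" using \<epsilon> Q0 by auto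
    have \<eta>: "\<bar>\<eta>\<bar> = 1" "- \<eta> * (\<epsilon> * Q) = \<bar>Q\<bar>"
      using \<epsilon> \<epsilon>Q by (auto simp: \<eta>_def abs_sgn_eq sgn_mult abs_mult sgn_if abs_if split: if_splits)
    have "\<eta> = 1 \<or> \<eta> = -1" using \<eta> by linarith
    then have odd: "sinh (\<eta> * x) = \<eta> * sinh x" for x by auto
    have sinh_eq: "sinh (a * (\<eta> * (angle t - C / a))) = \<bar>Q\<bar> * exp (- a / 2 * ln (R t))" if "t \<in> I" for t
    proof -
      have "a * (\<eta> * (angle t - C / a)) = \<eta> * - (C - a * angle t)"
        using a by (simp add: field_simps)
      then have "sinh (a * (\<eta> * (angle t - C / a))) = - \<eta> * sinh (C - a * angle t)"
        by (simp only: odd sinh_minus mult_minus_left mult_minus_right)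
      also have "\<dots> = - \<eta> * (\<epsilon> * Q) * exp (- a / 2 * ln (R t))"
        using C[OF that] by (simp add: a_def)
      finally show ?thesis unfolding \<eta>(2) .
    qed
    show ?thesis
      \<comment> \<open>The parameter \<open>c\<close> does not occur in the standard curve for \<open>\<alpha> \<noteq> -1\<close>; it is set to \<open>0\<close>.\<close>
    proof (rule std_curve_imageI[OF A0 \<eta>(1), of "\<bar>Q\<bar> powr (1 / a)" 0 "C / a"])
      show "\<eta> * (angle t - C / a) \<in> std_domain \<alpha>" if "t \<in> I" for t
      proof -
        have "sinh (a * (\<eta> * (angle t - C / a))) > 0" unfolding sinh_eq[OF that] using Q0 by simp
        then show ?thesis using False by (simp add: std_domain_def a_def)
      qed
      show "sqrt (R t) = \<bar>Q\<bar> powr (1 / a) * std_radius \<alpha> 0 (\<eta> * (angle t - C / a))" if "t \<in> I" for t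
      proof -
        have "std_radius \<alpha> 0 (\<eta> * (angle t - C / a)) =
            (\<bar>Q\<bar> * exp (- a / 2 * ln (R t))) powr (- 1 / a)"
          using False sinh_eq[OF that] by (simp add: std_radius_def a_def)
        also have "\<dots> = \<bar>Q\<bar> powr (- 1 / a) * exp (ln (R t) / 2)"
          using a by (simp add: powr_mult exp_powr_real)
        finally have "\<bar>Q\<bar> powr (1 / a) * std_radius \<alpha> 0 (\<eta> * (angle t - C / a)) =
            \<bar>Q\<bar> powr (1 / a + - 1 / a) * exp (ln (R t) / 2)"
          by (simp only: powr_add mult.assoc)
        then show ?thesis using Q0 unfolding sqrt_R[OF that] by simp
      qed
    qed (use Q0 False in auto)
  qed
qed

end

section \<open>Ends of the explicit curves\<close>

lemma eventually_std_domain: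
  "-1 < \<alpha> \<Longrightarrow> eventually (\<lambda>s. s \<in> std_domain \<alpha>) (at_right 0)"
  "-1 < \<alpha> \<Longrightarrow> eventually (\<lambda>s. s \<in> std_domain \<alpha>) at_top"
  "\<alpha> < -1 \<Longrightarrow> eventually (\<lambda>s. s \<in> std_domain \<alpha>) (at_left 0)"
  "\<alpha> < -1 \<Longrightarrow> eventually (\<lambda>s. s \<in> std_domain \<alpha>) at_bot"
proof -
  have r: "s \<in> std_domain \<alpha>" if "-1 < \<alpha>" "s > 0" for s
    using that by (simp add: std_domain_def)
  have l: "s \<in> std_domain \<alpha>" if "\<alpha> < -1" "s < 0" for s
    using that by (simp add: std_domain_def mult_neg_neg)
  show "-1 < \<alpha> \<Longrightarrow> eventually (\<lambda>s. s \<in> std_domain \<alpha>) (at_right 0)"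
    by (rule eventually_mono[OF eventually_at_right_less r])
  show "-1 < \<alpha> \<Longrightarrow> eventually (\<lambda>s. s \<in> std_domain \<alpha>) at_top"
    by (rule eventually_mono[OF eventually_gt_at_top[of 0] r])
  show "\<alpha> < -1 \<Longrightarrow> eventually (\<lambda>s. s \<in> std_domain \<alpha>) at_bot"
    by (rule eventually_mono[OF eventually_gt_at_bot[of 0] l])
  show "\<alpha> < -1 \<Longrightarrow> eventually (\<lambda>s. s \<in> std_domain \<alpha>) (at_left 0)"
    by (rule eventually_mono[OF _ l]) (auto simp: eventually_at_filter)
qed

text \<open>
  The exponential growth of \<open>sinh ((\<alpha> + 1) s)\<close>, raised to the power \<open>- 1 / (\<alpha> + 1)\<close>, is \<open>e\<^bsup>- s\<^esup>\<close> for both signs of \<open>\<alpha> + 1\<close>, so one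
  formula serves the end \<open>s \<rightarrow> \<infinity>\<close> for \<open>\<alpha> > -1\<close> and the end \<open>s \<rightarrow> - \<infinity>\<close> for \<open>\<alpha> < -1\<close>.
\<close>
lemma std_radius_exp:
  assumes "\<alpha> \<noteq> -1" "s \<in> std_domain \<alpha>"
  shows "std_radius \<alpha> c s * exp s =
    ((1 - exp (- 2 * ((\<alpha> + 1) * s))) / 2) powr (- 1 / (\<alpha> + 1))"
proof -
  define a where "a = \<alpha> + 1"
  have a: "a \<noteq> 0" "a * s > 0" using assms by (simp_all add: a_def std_domain_def)
  define D where "D = (1 - exp (- 2 * (a * s))) / 2"
  have D: "D \<ge> 0" using a by (simp add: D_def)
  have "sinh (a * s) = exp (a * s) * D"
    by (simp add: D_def sinh_field_def algebra_simps flip: exp_add)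
  then have "std_radius \<alpha> c s = exp (- s) * D powr (- 1 / a)"
    using assms(1) a D by (simp add: std_radius_def a_def[symmetric] powr_mult exp_powr_real)
  then show ?thesis by (simp add: D_def a_def exp_minus)
qed

lemma std_radius_exp_tendsto:
  assumes "\<alpha> \<noteq> -1" "eventually (\<lambda>s. s \<in> std_domain \<alpha>) F"
    and "filterlim (\<lambda>s. (\<alpha> + 1) * s) at_top F"
  shows "((\<lambda>s. std_radius \<alpha> c s * exp s) \<longlongrightarrow> (1 / 2) powr (- 1 / (\<alpha> + 1))) F"
proof (rule Lim_transform_eventually)
  have "filterlim (\<lambda>s. - 2 * ((\<alpha> + 1) * s)) at_bot F"
    by (rule filterlim_tendsto_neg_mult_at_bot[OF tendsto_const _ assms(3)]) simp
  then have "((\<lambda>s. exp (- 2 * ((\<alpha> + 1) * s))) \<longlongrightarrow> 0) F"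
    by (rule filterlim_compose[OF exp_at_bot])
  then have "((\<lambda>s. (1 - exp (- 2 * ((\<alpha> + 1) * s))) / 2) \<longlongrightarrow> (1 - 0) / 2) F"
    by (intro tendsto_intros) auto
  then show "((\<lambda>s. ((1 - exp (- 2 * ((\<alpha> + 1) * s))) / 2) powr (- 1 / (\<alpha> + 1)))
      \<longlongrightarrow> (1 / 2) powr (- 1 / (\<alpha> + 1))) F"
    by (intro tendsto_powr tendsto_const) simp_all
  show "eventually (\<lambda>s. ((1 - exp (- 2 * ((\<alpha> + 1) * s))) / 2) powr (- 1 / (\<alpha> + 1)) =
      std_radius \<alpha> c s * exp s) F"
    using assms(2) by (rule eventually_mono) (simp only: std_radius_exp[OF assms(1)])
qed

text \<open>
  Dividing the velocity by the positive factor \<open>cosh (\<alpha> s)\<close> leaves the direction \<open>(tanh (\<alpha> s), -1)\<close>, which has a nonzero limit.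
\<close>
lemma limit_direction_std_curve:
  assumes "\<alpha> \<noteq> -1" "eventually (\<lambda>s. s \<in> std_domain \<alpha>) F" "((\<lambda>s. tanh (\<alpha> * s)) \<longlongrightarrow> l) F"
  shows "limit_direction (std_curve \<alpha> c) F (sgn (l, -1))"
  unfolding limit_direction_def
proof (rule Lim_transform_eventually)
  show "((\<lambda>s. sgn (tanh (\<alpha> * s), -1 :: real)) \<longlongrightarrow> sgn (l, -1)) F"
    by (intro tendsto_sgn tendsto_Pair assms(3) tendsto_const) (simp add: zero_prod_def)
  show "eventually (\<lambda>s. sgn (tanh (\<alpha> * s), -1) = sgn (vderiv (std_curve \<alpha> c) s)) F"
    using assms(2)
  proof (rule eventually_mono)
    fix s assume s: "s \<in> std_domain \<alpha>"
    define g where "g = std_radius \<alpha> c s / sinh ((\<alpha> + 1) * s) * cosh (\<alpha> * s)"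
    have "g > 0"
      using std_radius_pos[OF s, of c] s assms(1) by (simp add: g_def std_domain_def)
    moreover have "vderiv (std_curve \<alpha> c) s = g *\<^sub>R (tanh (\<alpha> * s), -1)"
      by (simp add: vderiv_std_curve[OF assms(1) s] g_def tanh_def)
    ultimately show "sgn (tanh (\<alpha> * s), -1) = sgn (vderiv (std_curve \<alpha> c) s)"
      by (simp only: sgn_scaleR) simp
  qed
qed

lemma straight_line_in_light_cone:
  "straight_line (k, k) (v, v) \<subseteq> light_cone" "straight_line 0 (v, - v) \<subseteq> light_cone"
  by (auto simp: straight_line_def light_cone_def lor_def)

lemma sgn_diagonal:
  "sgn (x, x) = (x / norm (x, x), x / norm (x, x))" "sgn (x, - x) = (x / norm (x, x), - (x / norm (x, x)))"
  for x :: real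
  by (simp_all add: sgn_div_norm norm_Pair divide_inverse mult.commute)

lemma sinh_cosh_exp_factor:
  "sinh s = exp s * ((1 - exp (- 2 * s)) / 2)" "cosh s = exp s * ((1 + exp (- 2 * s)) / 2)" for s :: real
proof -
  have "exp s * exp (- 2 * s) = exp (- s)" by (simp flip: exp_add)
  then show "sinh s = exp s * ((1 - exp (- 2 * s)) / 2)" "cosh s = exp s * ((1 + exp (- 2 * s)) / 2)"
    by (simp_all add: sinh_field_def cosh_field_def right_diff_distrib distrib_left)
qed

lemma filterlim_scaled:
  fixes a :: real
  shows "a > 0 \<Longrightarrow> filterlim (\<lambda>s. a * s) at_top at_top"
    "a < 0 \<Longrightarrow> filterlim (\<lambda>s. a * s) at_bot at_top"
    "a < 0 \<Longrightarrow> filterlim (\<lambda>s. a * s) at_top at_bot"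
proof -
  show p: "filterlim (\<lambda>s. a * s) at_top at_top" if "a > 0" for a :: real
    by (rule filterlim_tendsto_pos_mult_at_top[OF tendsto_const that filterlim_ident])
  show "filterlim (\<lambda>s. a * s) at_bot at_top" if "a < 0"
    by (rule filterlim_tendsto_neg_mult_at_bot[OF tendsto_const that filterlim_ident])
  show "filterlim (\<lambda>s. a * s) at_top at_bot" if "a < 0"
    using p[of "- a"] that by (simp add: filterlim_at_bot_mirror)
qed

text \<open>
  Here \<open>\<rho>(s) \<sim> 2 k e\<^bsup>- s\<^esup>\<close>, while \<open>sinh s\<close> and \<open>cosh s\<close> are both asymptotic to \<open>e\<^bsup>s\<^esup> / 2\<close>.
\<close>
lemma std_curve_at_top:
  assumes "\<alpha> > -1"
  defines "k \<equiv> (1 / 2) powr (- 1 / (\<alpha> + 1)) / 2"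
  shows "(std_curve \<alpha> c \<longlongrightarrow> (k, k)) at_top"
proof -
  have eq: "std_curve \<alpha> c s =
      (std_radius \<alpha> c s * exp s) *\<^sub>R ((1 - exp (- 2 * s)) / 2, (1 + exp (- 2 * s)) / 2)" for s
    by (simp only: std_curve_def sinh_cosh_exp_factor scaleR_Pair real_scaleR_def mult.assoc)
  have "filterlim (\<lambda>s. (\<alpha> + 1) * s) at_top at_top"
    using assms by (intro filterlim_scaled) simp
  then have r: "((\<lambda>s. std_radius \<alpha> c s * exp s) \<longlongrightarrow> (1 / 2) powr (- 1 / (\<alpha> + 1))) at_top"
    using assms by (intro std_radius_exp_tendsto eventually_std_domain) auto
  have "filterlim (\<lambda>s::real. - 2 * s) at_bot at_top"
    by (rule filterlim_scaled) simp
  then have e: "((\<lambda>s::real. exp (- 2 * s)) \<longlongrightarrow> 0) at_top"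
    by (rule filterlim_compose[OF exp_at_bot])
  have "((\<lambda>s. (std_radius \<alpha> c s * exp s) *\<^sub>R ((1 - exp (- 2 * s)) / 2, (1 + exp (- 2 * s)) / 2))
      \<longlongrightarrow> (1 / 2) powr (- 1 / (\<alpha> + 1)) *\<^sub>R ((1 - 0) / 2, (1 + 0) / 2)) at_top"
    by (intro tendsto_scaleR r tendsto_Pair tendsto_divide tendsto_add tendsto_diff tendsto_const e) auto
  then show ?thesis by (simp add: eq[abs_def] k_def)
qed

lemma std_curve_orthogonal_to_cone:
  assumes "\<alpha> > 0"
  shows "\<exists>p. p \<noteq> 0 \<and> tends_to_orthogonally (std_curve \<alpha> c) at_top p"
proof -
  define k where "k = (1 / 2 :: real) powr (- 1 / (\<alpha> + 1)) / 2"
  have k: "k > 0" by (simp add: k_def)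
  have "filterlim (\<lambda>s. \<alpha> * s) at_top at_top"
    using assms by (intro filterlim_scaled) simp
  then have "((\<lambda>s. tanh (\<alpha> * s)) \<longlongrightarrow> 1) at_top"
    by (rule filterlim_compose[OF tanh_real_at_top])
  then have "limit_direction (std_curve \<alpha> c) at_top (sgn (1, -1))"
    using assms by (intro limit_direction_std_curve eventually_std_domain) auto
  moreover have "inner (sgn (1 :: real, -1 :: real)) (1, 1) = 0"
    using sgn_diagonal(2)[of 1] by simp
  moreover have "sgn (1 :: real, -1 :: real) \<noteq> 0" "(1 :: real, 1 :: real) \<noteq> 0"
    by (subst sgn_zero_iff) (simp_all add: zero_prod_def)
  moreover have "(k, k) \<in> light_cone" by (simp add: light_cone_def lor_def)
  moreover have "(std_curve \<alpha> c \<longlongrightarrow> (k, k)) at_top"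
    unfolding k_def using assms by (intro std_curve_at_top) simp
  ultimately have "tends_to_orthogonally (std_curve \<alpha> c) at_top (k, k)"
    unfolding tends_to_orthogonally_def using straight_line_in_light_cone(1)[of k 1] by blast
  then show ?thesis using k by (intro exI[of _ "(k, k)"]) (simp add: zero_prod_def)
qed

lemma std_curve_tangential_to_cone:
  assumes "-1 < \<alpha>" "\<alpha> < 0"
  shows "\<exists>p. p \<noteq> 0 \<and> tends_to_tangentially (std_curve \<alpha> c) at_top p"
proof -
  define k where "k = (1 / 2 :: real) powr (- 1 / (\<alpha> + 1)) / 2"
  have k: "k > 0" by (simp add: k_def)
  have "filterlim (\<lambda>s. \<alpha> * s) at_bot at_top"
    using assms by (intro filterlim_scaled) simp
  then have "((\<lambda>s. tanh (\<alpha> * s)) \<longlongrightarrow> -1) at_top"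
    by (rule filterlim_compose[OF tanh_real_at_bot])
  then have "limit_direction (std_curve \<alpha> c) at_top (sgn (-1, -1))"
    using assms by (intro limit_direction_std_curve eventually_std_domain) auto
  moreover have "(std_curve \<alpha> c \<longlongrightarrow> (k, k)) at_top"
    unfolding k_def using assms by (intro std_curve_at_top) simp
  moreover have "sgn (-1 :: real, -1 :: real) \<noteq> 0"
    by (subst sgn_zero_iff) (simp add: zero_prod_def)
  moreover have "(k, k) \<in> light_cone" by (simp add: light_cone_def lor_def)
  moreover have "straight_line (k, k) (sgn (-1, -1)) \<subseteq> light_cone"
    unfolding sgn_diagonal by (rule straight_line_in_light_cone)
  ultimately have "tends_to_tangentially (std_curve \<alpha> c) at_top (k, k)"
    unfolding tends_to_tangentially_def by blast
  then show ?thesis using k by (intro exI[of _ "(k, k)"]) (simp add: zero_prod_def)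
qed

lemma std_radius_eq:
  assumes "\<alpha> \<noteq> -1" shows "std_radius \<alpha> c s = sinh ((\<alpha> + 1) * s) powr (- 1 / (\<alpha> + 1))"
  using assms by (simp add: std_radius_def)

lemma sinh_scaled_tendsto_0: "((\<lambda>s. sinh (a * s)) \<longlongrightarrow> 0) (at (0::real) within S)"
  for a :: real
proof -
  have "((\<lambda>s. sinh (a * s)) \<longlongrightarrow> sinh (a * 0)) (at (0::real) within S)"
    by (intro tendsto_sinh tendsto_intros)
  then show ?thesis by simp
qed

text \<open>
  The distance to the axis is \<open>\<rho> sinh s\<close>. As \<open>sinh s \<le> sinh ((\<alpha> + 1) s)\<close>, it is at most
  \<open>sinh ((\<alpha> + 1) s)\<close> to the power \<open>1 - 1 / (\<alpha> + 1) = \<alpha> / (\<alpha> + 1) > 0\<close>.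
\<close>
lemma std_curve_asymptotic_to_y_axis:
  assumes "\<alpha> > 0"
  shows "asymptotic_to_line (std_curve \<alpha> c) (at_right 0) y_axis"
proof -
  define a where "a = \<alpha> + 1"
  have a: "a > 1" using assms by (simp add: a_def)
  have sh0: "((\<lambda>s. sinh (a * s)) \<longlongrightarrow> 0) (at_right 0)" by (rule sinh_scaled_tendsto_0)
  have pos: "eventually (\<lambda>s::real. s > 0) (at_right 0)" by (rule eventually_at_right_less)
  have "filterlim (\<lambda>s. sinh (a * s) powr (1 / a)) (at_right 0) (at_right 0)"
    unfolding filterlim_at
  proof
    show "eventually (\<lambda>s. sinh (a * s) powr (1 / a) \<in> {0<..} \<and> sinh (a * s) powr (1 / a) \<noteq> 0) (at_right 0)"
      using pos by (rule eventually_mono) (use a in auto)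
    show "((\<lambda>s. sinh (a * s) powr (1 / a)) \<longlongrightarrow> 0) (at_right 0)"
      by (rule tendsto_zero_powrI[OF sh0 tendsto_const])
        (use a pos in \<open>auto elim!: eventually_mono\<close>)
  qed
  then have inverse: "filterlim (\<lambda>s. inverse (sinh (a * s) powr (1 / a))) at_top (at_right 0)"
    by (rule filterlim_compose[OF filterlim_inverse_at_top_right])
  have top: "filterlim (std_radius \<alpha> c) at_top (at_right 0)"
  proof -
    have "std_radius \<alpha> c = (\<lambda>s. inverse (sinh (a * s) powr (1 / a)))"
      using assms by (intro ext) (simp add: std_radius_eq a_def powr_minus)
    with inverse show ?thesis by simp
  qed
  have "filterlim (\<lambda>s. norm (std_curve \<alpha> c s)) at_top (at_right 0)"
  proof (rule filterlim_at_top_mono[OF top], rule eventually_mono[OF pos])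
    fix s :: real assume "s > 0"
    then have "std_radius \<alpha> c s \<ge> 0" using assms by (simp add: std_radius_eq)
    moreover have "1 \<le> norm (sinh s, cosh s)"
      using norm_snd_le[of "cosh s" "sinh s"] cosh_real_ge_1[of s] by simp
    ultimately show "std_radius \<alpha> c s \<le> norm (std_curve \<alpha> c s)"
      by (simp add: std_curve_def mult_left_le[of "norm (sinh s, cosh s)"] mult_le_cancel_left1 del: scaleR_Pair)
  qed
  then have inf: "filterlim (std_curve \<alpha> c) at_infinity (at_right 0)"
    by (rule filterlim_norm_at_top_imp_at_infinity)
  have "((\<lambda>s. infdist (std_curve \<alpha> c s) y_axis) \<longlongrightarrow> 0) (at_right 0)"
  proof (rule real_tendsto_sandwich[of "\<lambda>_. 0" _ _ "\<lambda>s. sinh (a * s) powr (\<alpha> / a)"])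
    show "((\<lambda>s. sinh (a * s) powr (\<alpha> / a)) \<longlongrightarrow> 0) (at_right 0)"
      by (rule tendsto_zero_powrI[OF sh0 tendsto_const])
        (use a assms pos in \<open>auto elim!: eventually_mono\<close>)
    show "eventually (\<lambda>s. infdist (std_curve \<alpha> c s) y_axis \<le> sinh (a * s) powr (\<alpha> / a)) (at_right 0)"
      using pos
    proof (rule eventually_mono)
      fix s :: real assume s: "s > 0"
      define \<rho> where "\<rho> = std_radius \<alpha> c s"
      have \<rho>: "\<rho> \<ge> 0" using assms by (simp add: \<rho>_def std_radius_eq)
      have "(0, \<rho> * cosh s) \<in> y_axis" by (auto simp: y_axis_def straight_line_def)
      then have "infdist (std_curve \<alpha> c s) y_axis \<le> dist (std_curve \<alpha> c s) (0, \<rho> * cosh s)"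
        by (rule infdist_le)
      also have "\<dots> = \<rho> * sinh s"
        using \<rho> s by (simp add: std_curve_def \<rho>_def dist_Pair_Pair)
      also have "\<dots> \<le> \<rho> * sinh (a * s)"
        using \<rho> a s by (intro mult_left_mono) simp_all
      also have "\<dots> = sinh (a * s) powr (- 1 / a) * sinh (a * s) powr 1"
        using assms a s by (simp add: \<rho>_def std_radius_eq a_def)
      also have "\<dots> = sinh (a * s) powr (\<alpha> / a)"
        using a by (simp only: powr_add[symmetric]) (simp add: a_def field_simps)
      finally show "infdist (std_curve \<alpha> c s) y_axis \<le> sinh (a * s) powr (\<alpha> / a)" .
    qed
  qed (simp_all add: infdist_nonneg)
  with inf show ?thesis by (simp add: asymptotic_to_line_def)
qed

text \<open>
  Each exponential in \<open>e\<^bsup>c s\<^esup> (sinh s, cosh s)\<close> decays as \<open>s \<rightarrow> - \<infinity>\<close> if \<open>c > 1\<close> and as \<open>s \<rightarrow> \<infinity>\<close> if \<open>c < -1\<close>. In the velocity the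
  term with \<open>e\<^bsup>- s\<^esup>\<close>, respectively \<open>e\<^bsup>s\<^esup>\<close>, dominates and points along the cone.
\<close>
lemma std_curve_exp_tangential:
  assumes "c\<^sup>2 > 1"
  shows "\<exists>B\<in>{at_bot, at_top}. tends_to_tangentially (std_curve (-1) c) B 0"
proof -
  \<comment> \<open>Replacing \<open>(s, c)\<close> by \<open>(- s, - c)\<close> reflects the curve in the \<open>y\<close>-axis and exchanges the two ends.
    The sign \<open>\<delta>\<close> records which end is approached, so that both cases look like \<open>s \<rightarrow> \<infinity>\<close> with
    \<open>c < -1\<close>.\<close>
  have branch: "tends_to_tangentially (std_curve (-1) c) F 0"
    if \<delta>: "\<delta> = 1 \<or> \<delta> = -1" and c\<delta>: "\<delta> * c < -1" and F: "filterlim (\<lambda>s. \<delta> * s) at_top F" for \<delta> F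
  proof -
    have sd: "\<delta> * \<delta> = 1" using \<delta> by auto
    have sinh_d: "sinh s = \<delta> * sinh (\<delta> * s)" and cosh_d: "cosh s = cosh (\<delta> * s)" for s :: real
      using \<delta> by auto
    have e: "((\<lambda>s. exp (k * (\<delta> * s))) \<longlongrightarrow> 0) F" if "k < 0" for k
      by (rule filterlim_compose[OF exp_at_bot filterlim_tendsto_neg_mult_at_bot[OF tendsto_const that F]])
    define d where "d = \<delta> * c"
    have c: "c = \<delta> * d" using sd by (simp add: d_def flip: mult.assoc)
    have "std_curve (-1) c s = ((exp ((d + 1) * (\<delta> * s)) - exp ((d - 1) * (\<delta> * s))) / 2 * \<delta>,
        (exp ((d + 1) * (\<delta> * s)) + exp ((d - 1) * (\<delta> * s))) / 2)" for s :: real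
      unfolding std_curve_def std_radius_def sinh_d[of s] cosh_d[of s] c
      by (simp add: sinh_field_def cosh_field_def distrib_right left_diff_distrib exp_add exp_diff
          exp_minus field_simps)
    moreover have "((\<lambda>s. ((exp ((d + 1) * (\<delta> * s)) - exp ((d - 1) * (\<delta> * s))) / 2 * \<delta>,
        (exp ((d + 1) * (\<delta> * s)) + exp ((d - 1) * (\<delta> * s))) / 2)) \<longlongrightarrow> ((0 - 0) / 2 * \<delta>, (0 + 0) / 2)) F"
      using c\<delta> unfolding d_def
      by (intro tendsto_Pair tendsto_mult tendsto_divide tendsto_add tendsto_diff tendsto_const e) auto
    ultimately have "(std_curve (-1) c \<longlongrightarrow> ((0 - 0) / 2 * \<delta>, (0 + 0) / 2)) F"
      by presburger
    then have lim: "(std_curve (-1) c \<longlongrightarrow> 0) F"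
      by (simp add: zero_prod_def)
    define x where "x = d + 1"
    have x: "x \<noteq> 0" using c\<delta> by (simp add: x_def d_def)
    have dir: "limit_direction (std_curve (-1) c) F (sgn (x, \<delta> * x))"
      unfolding limit_direction_def
    proof (rule Lim_transform_eventually)
      let ?E = "\<lambda>s. exp (- 2 * (\<delta> * s))"
      have "((\<lambda>s. sgn (d * (1 - ?E s) + (1 + ?E s), \<delta> * (d * (1 + ?E s) + (1 - ?E s))))
          \<longlongrightarrow> sgn (d * (1 - 0) + (1 + 0), \<delta> * (d * (1 + 0) + (1 - 0)))) F"
        using x unfolding x_def
        by (intro tendsto_sgn tendsto_Pair tendsto_intros e) (auto simp: zero_prod_def)
      then show "((\<lambda>s. sgn (d * (1 - ?E s) + (1 + ?E s), \<delta> * (d * (1 + ?E s) + (1 - ?E s))))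
          \<longlongrightarrow> sgn (x, \<delta> * x)) F"
        by (simp add: x_def)
      show "eventually (\<lambda>s. sgn (d * (1 - ?E s) + (1 + ?E s), \<delta> * (d * (1 + ?E s) + (1 - ?E s))) =
          sgn (vderiv (std_curve (-1) c) s)) F"
      proof (rule always_eventually, rule allI)
        fix s
        define u where "u = \<delta> * s"
        have u: "cosh u = exp u / 2 * (1 + ?E s)" "sinh u = exp u / 2 * (1 - ?E s)"
          unfolding u_def[symmetric]
          using sinh_cosh_exp_factor[of u] by simp_all
        have "(c * sinh s + cosh s, c * cosh s + sinh s) =
            (\<delta> * \<delta> * d * sinh u + cosh u, \<delta> * (d * cosh u + sinh u))"
          unfolding sinh_d[of s] cosh_d[of s] c u_def by (simp add: algebra_simps)
        also have "\<dots> = (exp u / 2) *\<^sub>R (d * (1 - ?E s) + (1 + ?E s), \<delta> * (d * (1 + ?E s) + (1 - ?E s)))"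
          unfolding u sd by (simp add: algebra_simps)
        finally show "sgn (d * (1 - ?E s) + (1 + ?E s), \<delta> * (d * (1 + ?E s) + (1 - ?E s))) =
            sgn (vderiv (std_curve (-1) c) s)"
          unfolding vderiv_std_curve_exp by (simp add: sgn_scaleR del: scaleR_Pair)
      qed
    qed
    have "straight_line 0 (sgn (x, \<delta> * x)) \<subseteq> light_cone"
      using \<delta>
    proof
      assume "\<delta> = 1" then show ?thesis
        using straight_line_in_light_cone(1)[of 0] by (simp add: sgn_diagonal zero_prod_def)
    next
      assume "\<delta> = -1" then show ?thesis
        using straight_line_in_light_cone(2) by (simp add: sgn_diagonal)
    qed
    with lim dir x show ?thesis
      unfolding tends_to_tangentially_def
    proof (intro conjI exI[of _ "sgn (x, \<delta> * x)"])
      show "sgn (x, \<delta> * x) \<noteq> 0" using x by (subst sgn_zero_iff) (simp add: zero_prod_def)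
      show "0 \<in> light_cone" by (simp add: light_cone_def lor_def)
    qed
  qed
  have "\<bar>c\<bar> > 1" using assms abs_square_le_1[of c] by linarith
  then consider "c > 1" | "c < -1" by linarith
  then show ?thesis
  proof cases
    case 1
    then have "tends_to_tangentially (std_curve (-1) c) at_bot 0"
      by (intro branch[of "-1"]) (simp_all add: filterlim_uminus_at_top_at_bot)
    then show ?thesis by blast
  next
    case 2
    then have "tends_to_tangentially (std_curve (-1) c) at_top 0"
      by (intro branch[of 1]) (simp_all add: filterlim_ident)
    then show ?thesis by blast
  qed
qed

lemma std_curve_to_origin_along_y_axis:
  assumes "\<alpha> < -1"
  shows "tends_to_origin_along_y_axis (std_curve \<alpha> c) (at_left 0)"
proof -
  define a where "a = \<alpha> + 1"
  have a: "a < 0" using assms by (simp add: a_def)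
  have neg: "eventually (\<lambda>s::real. s < 0) (at_left 0)" by (auto simp: eventually_at_filter)
  have "((\<lambda>s. sinh (a * s) powr (- 1 / a)) \<longlongrightarrow> 0) (at_left 0)"
    by (rule tendsto_zero_powrI[OF sinh_scaled_tendsto_0 tendsto_const])
      (use a neg in \<open>auto elim!: eventually_mono simp: mult_nonpos_nonpos divide_neg_neg\<close>)
  then have "((\<lambda>s. std_curve \<alpha> c s) \<longlongrightarrow> 0 *\<^sub>R (sinh 0, cosh 0)) (at_left 0)"
    using assms unfolding std_curve_def
    by (intro tendsto_scaleR tendsto_Pair tendsto_sinh tendsto_cosh tendsto_ident_at)
      (simp add: std_radius_eq a_def)
  moreover have "((\<lambda>s. tanh (\<alpha> * s)) \<longlongrightarrow> tanh (\<alpha> * 0)) (at_left 0)"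
    by (intro tendsto_tanh tendsto_intros) auto
  then have "limit_direction (std_curve \<alpha> c) (at_left 0) (sgn (0, -1))"
    using assms by (intro limit_direction_std_curve eventually_std_domain) auto
  moreover have "sgn (0 :: real, -1 :: real) = (0, -1)" by (simp add: sgn_div_norm norm_Pair)
  moreover have "straight_line 0 (0, -1) = y_axis"
  proof -
    have "p \<in> straight_line 0 (0, b) \<longleftrightarrow> fst p = 0" if "b \<noteq> 0" for p and b :: real
    proof
      assume "fst p = 0"
      then have "p = 0 + (snd p / b) *\<^sub>R (0, b)" using that by (simp add: prod_eq_iff)
      then show "p \<in> straight_line 0 (0, b)" unfolding straight_line_def by blast
    qed (auto simp: straight_line_def)
    then show ?thesis unfolding y_axis_def by (intro set_eqI) simp
  qed
  ultimately show ?thesis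
    unfolding tends_to_origin_along_y_axis_def
    by (intro conjI exI[of _ "(0, -1)"]) (simp_all add: zero_prod_def)
qed

text \<open>
  Along \<open>s \<rightarrow> - \<infinity>\<close> the lightlike coordinate \<open>x + y = \<rho> e\<^bsup>s\<^esup>\<close> converges to a constant \<open>k\<close> while \<open>y - x = \<rho> e\<^bsup>- s\<^esup>\<close> diverges. The
  asymptote is the line \<open>x + y = k\<close>.
\<close>
lemma std_curve_asymptotic_to_translated_cone:
  assumes "\<alpha> < -1"
  shows "asymptotic_to_translated_cone (std_curve \<alpha> c) at_bot"
proof -
  define k where "k = (1 / 2 :: real) powr (- 1 / (\<alpha> + 1))"
  define L where "L = straight_line (k / 2, k / 2) (1, -1)"
  have "filterlim (\<lambda>s. (\<alpha> + 1) * s) at_top at_bot"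
    using assms by (intro filterlim_scaled) simp
  then have lim: "((\<lambda>s. std_radius \<alpha> c s * exp s) \<longlongrightarrow> k) at_bot"
    unfolding k_def using assms by (intro std_radius_exp_tendsto eventually_std_domain) auto
  have k: "k > 0" by (simp add: k_def)
  have "filterlim (\<lambda>s::real. exp (- 2 * s)) at_top at_bot"
    by (rule filterlim_compose[OF exp_at_top filterlim_scaled(3)]) simp
  then have "filterlim (\<lambda>s::real. exp (- 2 * s) + 1) at_top at_bot"
    by (rule filterlim_at_top_mono) simp
  from filterlim_tendsto_pos_mult_at_top[OF lim k this]
  have top: "filterlim (\<lambda>s. std_radius \<alpha> c s * exp s * (exp (- 2 * s) + 1)) at_top at_bot" .
  have "filterlim (\<lambda>s. norm (std_curve \<alpha> c s)) at_top at_bot"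
  proof (rule filterlim_at_top_mono)
    show "filterlim (\<lambda>s. 1 / 2 * (std_radius \<alpha> c s * exp s * (exp (- 2 * s) + 1))) at_top at_bot"
      by (rule filterlim_tendsto_pos_mult_at_top[OF tendsto_const _ top]) simp
    have snd_le_norm: "snd p \<le> norm p" for p :: "real \<times> real"
      using norm_snd_le[of "snd p" "fst p"] by simp
    have "1 / 2 * (std_radius \<alpha> c s * exp s * (exp (- 2 * s) + 1)) = snd (std_curve \<alpha> c s)" for s
      by (simp add: std_curve_def cosh_field_def algebra_simps flip: exp_add)
    then show "eventually (\<lambda>s. 1 / 2 * (std_radius \<alpha> c s * exp s * (exp (- 2 * s) + 1)) \<le>
        norm (std_curve \<alpha> c s)) at_bot"
      using snd_le_norm by simp
  qed
  then have "filterlim (std_curve \<alpha> c) at_infinity at_bot"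
    by (rule filterlim_norm_at_top_imp_at_infinity)
  moreover have "((\<lambda>s. infdist (std_curve \<alpha> c s) L) \<longlongrightarrow> 0) at_bot"
  proof (rule real_tendsto_sandwich[of "\<lambda>_. 0" _ _
        "\<lambda>s. norm (((std_radius \<alpha> c s * exp s - k) / 2) *\<^sub>R (1 :: real, 1 :: real))"])
    have "((\<lambda>s. norm (((std_radius \<alpha> c s * exp s - k) / 2) *\<^sub>R (1 :: real, 1 :: real))) \<longlongrightarrow>
        norm (((k - k) / 2) *\<^sub>R (1 :: real, 1 :: real))) at_bot"
      by (intro tendsto_intros lim) auto
    then show "((\<lambda>s. norm (((std_radius \<alpha> c s * exp s - k) / 2) *\<^sub>R (1 :: real, 1 :: real))) \<longlongrightarrow> 0) at_bot"
      by (simp add: zero_prod_def[symmetric])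
    show "eventually (\<lambda>s. infdist (std_curve \<alpha> c s) L \<le>
        norm (((std_radius \<alpha> c s * exp s - k) / 2) *\<^sub>R (1 :: real, 1 :: real))) at_bot"
    proof (rule always_eventually, rule allI)
      fix s
      define \<rho> where "\<rho> = std_radius \<alpha> c s"
      \<comment> \<open>The Euclidean foot of the perpendicular from the curve point to \<open>L\<close>.\<close>
      define q where "q = (k / 2, k / 2) + (- \<rho> * exp (- s) / 2) *\<^sub>R (1, -1 :: real)"
      have "q \<in> L" by (auto simp: q_def L_def straight_line_def)
      then have "infdist (std_curve \<alpha> c s) L \<le> dist (std_curve \<alpha> c s) q"
        by (rule infdist_le)
      also have "std_curve \<alpha> c s - q = ((\<rho> * exp s - k) / 2) *\<^sub>R (1, 1)"
        by (simp add: std_curve_def q_def \<rho>_def sinh_field_def cosh_field_def field_simps)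
      then have "dist (std_curve \<alpha> c s) q = norm (((\<rho> * exp s - k) / 2) *\<^sub>R (1 :: real, 1 :: real))"
        by (simp only: dist_norm)
      finally show "infdist (std_curve \<alpha> c s) L \<le>
          norm (((std_radius \<alpha> c s * exp s - k) / 2) *\<^sub>R (1 :: real, 1 :: real))"
        by (simp only: \<rho>_def)
    qed
  qed (simp_all add: infdist_nonneg)
  ultimately have "asymptotic_to_line (std_curve \<alpha> c) at_bot L"
    by (simp add: asymptotic_to_line_def)
  then show ?thesis
    unfolding asymptotic_to_translated_cone_def L_def
    using straight_line_in_light_cone(2)[of 1]
    by (intro exI[of _ "(k / 2, k / 2)"] exI[of _ "(1, -1)"]) (simp add: zero_prod_def)
qed

lemma at_right_neq_at_top: "at_right (0::real) \<noteq> at_top"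
proof
  assume "at_right (0::real) = at_top"
  moreover have "eventually (\<lambda>s::real. s < 1) (at_right 0)"
    by (auto simp: eventually_at_right_field intro: exI[of _ 1])
  ultimately have "eventually (\<lambda>s::real. s < 1) at_top" by simp
  with eventually_gt_at_top[of "1::real"] have "eventually (\<lambda>s::real. False) at_top"
    by eventually_elim simp
  then show False by simp
qed

lemma at_left_neq_at_bot: "at_left (0::real) \<noteq> at_bot"
proof
  assume "at_left (0::real) = at_bot"
  moreover have "eventually (\<lambda>s::real. s > -1) (at_left 0)"
    by (auto simp: eventually_at_left_field intro: exI[of _ "-1"])
  ultimately have "eventually (\<lambda>s::real. s > -1) at_bot" by simp
  with eventually_gt_at_bot[of "-1::real"] have "eventually (\<lambda>s::real. False) at_bot"
    by eventually_elim simp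
  then show False by simp
qed

section \<open>Classification\<close>

theorem theorem4p5:
  fixes \<alpha> :: real
  shows
    "(\<forall>(\<gamma> :: real \<Rightarrow> real \<times> real) I.
        (stationary \<alpha> \<gamma> I \<and> timelike \<gamma> I \<and> \<gamma> ` I \<subseteq> neg_region \<and>
         \<not> radial \<gamma> I)
        \<longleftrightarrow>
        (\<exists>T \<mu> c K \<phi>. linear_isometry T \<and> \<mu> > 0 \<and> (\<alpha> = -1 \<longrightarrow> c\<^sup>2 > 1) \<and>
           K \<subseteq> std_domain \<alpha> \<and> reparametrization \<phi> I K \<and>
           (\<forall>t\<in>I. \<gamma> t = \<mu> *\<^sub>R T (std_curve \<alpha> c (\<phi> t)))))
     \<and>
     (\<forall>c::real. (\<alpha> = -1 \<longrightarrow> c\<^sup>2 > 1) \<longrightarrow>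
        (\<alpha> > 0 \<longrightarrow>
          (\<exists>B B'. branches \<alpha> = {B, B'} \<and> B \<noteq> B' \<and>
             (\<exists>p. p \<noteq> 0 \<and> tends_to_orthogonally (std_curve \<alpha> c) B p) \<and>
             asymptotic_to_line (std_curve \<alpha> c) B' y_axis)) \<and>
        (-1 < \<alpha> \<and> \<alpha> < 0 \<longrightarrow>
          (\<exists>B\<in>branches \<alpha>. \<exists>p. p \<noteq> 0 \<and> tends_to_tangentially (std_curve \<alpha> c) B p)) \<and>
        (\<alpha> = -1 \<longrightarrow>
          (\<exists>B\<in>branches \<alpha>. tends_to_tangentially (std_curve \<alpha> c) B 0)) \<and>
        (\<alpha> < -1 \<longrightarrow>
          (\<exists>B B'. branches \<alpha> = {B, B'} \<and> B \<noteq> B' \<and>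
             tends_to_origin_along_y_axis (std_curve \<alpha> c) B \<and>
             asymptotic_to_translated_cone (std_curve \<alpha> c) B')))"
proof (intro conjI allI impI)
  fix \<gamma> :: "real \<Rightarrow> real \<times> real" and I
  show "(stationary \<alpha> \<gamma> I \<and> timelike \<gamma> I \<and> \<gamma> ` I \<subseteq> neg_region \<and> \<not> radial \<gamma> I) \<longleftrightarrow>
    (\<exists>T \<mu> c K \<phi>. linear_isometry T \<and> \<mu> > 0 \<and> (\<alpha> = -1 \<longrightarrow> c\<^sup>2 > 1) \<and>
       K \<subseteq> std_domain \<alpha> \<and> reparametrization \<phi> I K \<and>
       (\<forall>t\<in>I. \<gamma> t = \<mu> *\<^sub>R T (std_curve \<alpha> c (\<phi> t))))" (is "?stat \<longleftrightarrow> ?image")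
  proof
    assume s: ?stat
    then have reg: "regular_curve \<gamma> I" by (simp add: stationary_def)
    have "stationary_timelike_curve \<alpha> \<gamma> I"
    proof
      show "stationary_equation \<alpha> (\<gamma> t) (vderiv \<gamma> t) (vderiv (vderiv \<gamma>) t)" if "t \<in> I" for t
        using stationary_iff_equation[OF reg, of \<alpha>] s that by blast
    qed (use s reg in \<open>simp_all add: regular_curve_def\<close>)
    then show ?image using s by (intro stationary_timelike_curve.nonradial_is_std_curve_image) simp_all
  next
    assume ?image
    then obtain T \<mu> c K \<phi> where
      h: "linear_isometry T" "\<mu> > 0" "\<alpha> = -1 \<longrightarrow> c\<^sup>2 > 1" "K \<subseteq> std_domain \<alpha>" "reparametrization \<phi> I K"
      and \<gamma>: "\<And>t. t \<in> I \<Longrightarrow> \<gamma> t = \<mu> *\<^sub>R T (std_curve \<alpha> c (\<phi> t))"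
      by blast
    show ?stat by (intro conjI std_curve_image_stationary[OF h \<gamma>])
  qed
next
  fix c assume \<alpha>: "\<alpha> > 0"
  have "branches \<alpha> = {at_top, at_right 0}"
    using \<alpha> by (simp add: branches_def insert_commute)
  then show "\<exists>B B'. branches \<alpha> = {B, B'} \<and> B \<noteq> B' \<and>
      (\<exists>p. p \<noteq> 0 \<and> tends_to_orthogonally (std_curve \<alpha> c) B p) \<and>
      asymptotic_to_line (std_curve \<alpha> c) B' y_axis"
    using std_curve_orthogonal_to_cone[OF \<alpha>] std_curve_asymptotic_to_y_axis[OF \<alpha>]
      at_right_neq_at_top[symmetric] by blast
next
  fix c assume \<alpha>: "-1 < \<alpha> \<and> \<alpha> < 0"
  then have "at_top \<in> branches \<alpha>" by (simp add: branches_def)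
  with \<alpha> show "\<exists>B\<in>branches \<alpha>. \<exists>p. p \<noteq> 0 \<and> tends_to_tangentially (std_curve \<alpha> c) B p"
    using std_curve_tangential_to_cone by blast
next
  fix c :: real assume c: "\<alpha> = -1 \<longrightarrow> c\<^sup>2 > 1" and \<alpha>: "\<alpha> = -1"
  have "branches \<alpha> = {at_bot, at_top}" by (simp add: branches_def \<alpha>)
  moreover have "\<exists>B\<in>{at_bot, at_top}. tends_to_tangentially (std_curve \<alpha> c) B 0"
    unfolding \<alpha> using c \<alpha> by (intro std_curve_exp_tangential) blast
  ultimately show "\<exists>B\<in>branches \<alpha>. tends_to_tangentially (std_curve \<alpha> c) B 0"
    by (simp only:)
next
  fix c assume \<alpha>: "\<alpha> < -1"
  have "branches \<alpha> = {at_left 0, at_bot}"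
    using \<alpha> by (simp add: branches_def insert_commute)
  then show "\<exists>B B'. branches \<alpha> = {B, B'} \<and> B \<noteq> B' \<and>
      tends_to_origin_along_y_axis (std_curve \<alpha> c) B \<and>
      asymptotic_to_translated_cone (std_curve \<alpha> c) B'"
    using std_curve_to_origin_along_y_axis[OF \<alpha>] std_curve_asymptotic_to_translated_cone[OF \<alpha>]
      at_left_neq_at_bot by blast
qed

end
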